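(* Let $n\ge 3$ be an integer and let $1<\beta<2$ be the largest positive real number satisfying $\beta^n=\beta^{n-2}+\beta^{n-3}+\cdots+\beta+1$. Then the induced transformation $I=K_{\Omega\times[a,b]}$ of the shrinking random $\beta$-transformation $K$ is intrinsically ergodic (that is, it has a unique measure of maximal entropy), and its maximal entropy is $\log(2n-2)$.
   Context: Let $\Omega=\{0,1\}^{\mathbb N}$ with the product $\sigma$-algebra and left shift $\sigma$, $E=[0,(\beta-1)^{-1}]$ with the Borel $\sigma$-algebra, $a=(\beta^2-1)^{-1}$ and $b=\beta(\beta^2-1)^{-1}$. The shrinking random $\beta$-transformation $K:\Omega\times E\to\Omega\times E$ is $$K(\omega,x)=\begin{cases}(\omega,\beta x)& x\in[0,a),\\ (\sigma(\omega),\beta x-\omega_1)& x\in[a,b],\\ (\omega,\beta x-1)& x\in(b,(\beta-1)^{-1}].\end{cases}$$ For $(\omega,x)\in\Omega\times[a,b]$ the first return time is $\tau(\omega,x)=\min\{k\ge 1: K^k(\omega,x)\in\Omega\times[a,b]\}$, and $I:\Omega\times[a,b]\to\Omega\times[a,b]$ is $I(\omega,x)=K^{\tau(\omega,x)}(\omega,x)$. A measure of maximal entropy for $I$ is an $I$-invariant probability measure whose Kolmogorov–Sinai entropy equals the supremum of the entropies of all $I$-invariant probability measures; this supremum is the maximal entropy. *)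

theory Defs
  imports "HOL-Probability.Probability"
begin

section \<open>Kolmogorov--Sinai entropy and measures of maximal entropy\<close>

definition invariant_probs :: "'a measure \<Rightarrow> ('a \<Rightarrow> 'a) \<Rightarrow> 'a measure set" where
  "invariant_probs M T =
     {\<mu>. prob_space \<mu> \<and> sets \<mu> = sets M \<and> T \<in> \<mu> \<rightarrow>\<^sub>M \<mu> \<and> distr \<mu> \<mu> T = \<mu>}"

definition finite_partitions :: "'a measure \<Rightarrow> 'a set set set" where
  "finite_partitions \<mu> = {P. finite P \<and> P \<subseteq> sets \<mu> \<and> partition_on (space \<mu>) P}"

text \<open>The convention \<open>0 log 0 = 0\<close> holds automatically; all logarithms are natural.\<close>

definition partition_entropy :: "'a measure \<Rightarrow> 'a set set \<Rightarrow> real" where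
  "partition_entropy \<mu> P = - (\<Sum>A\<in>P. measure \<mu> A * ln (measure \<mu> A))"

definition pullback_partition :: "'a measure \<Rightarrow> ('a \<Rightarrow> 'a) \<Rightarrow> 'a set set \<Rightarrow> 'a set set" where
  "pullback_partition \<mu> T P = (\<lambda>A. T -` A \<inter> space \<mu>) ` P - {{}}"

text \<open>The join of the partitions \<open>P, T\<^sup>-\<^sup>1 P, \<dots>, T\<^sup>-\<^sup>(\<^sup>n\<^sup>-\<^sup>1\<^sup>) P\<close>, for \<open>n \<ge> 1\<close>.\<close>

definition iterated_join :: "'a measure \<Rightarrow> ('a \<Rightarrow> 'a) \<Rightarrow> nat \<Rightarrow> 'a set set \<Rightarrow> 'a set set" where
  "iterated_join \<mu> T n P =
     common_refinement ((\<lambda>i. pullback_partition \<mu> (T ^^ i) P) ` {..<n})"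

definition entropy_wrt_partition :: "'a measure \<Rightarrow> ('a \<Rightarrow> 'a) \<Rightarrow> 'a set set \<Rightarrow> real" where
  "entropy_wrt_partition \<mu> T P =
     lim (\<lambda>n. partition_entropy \<mu> (iterated_join \<mu> T n P) / real n)"

definition ks_entropy :: "'a measure \<Rightarrow> ('a \<Rightarrow> 'a) \<Rightarrow> ereal" where
  "ks_entropy \<mu> T = (SUP P\<in>finite_partitions \<mu>. ereal (entropy_wrt_partition \<mu> T P))"

definition maximal_entropy :: "'a measure \<Rightarrow> ('a \<Rightarrow> 'a) \<Rightarrow> ereal" where
  "maximal_entropy M T = (SUP \<mu>\<in>invariant_probs M T. ks_entropy \<mu> T)"

definition measure_of_maximal_entropy ::
  "'a measure \<Rightarrow> ('a \<Rightarrow> 'a) \<Rightarrow> 'a measure \<Rightarrow> bool" where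
  "measure_of_maximal_entropy M T \<mu> \<longleftrightarrow>
     \<mu> \<in> invariant_probs M T \<and> ks_entropy \<mu> T = maximal_entropy M T"

definition intrinsically_ergodic :: "'a measure \<Rightarrow> ('a \<Rightarrow> 'a) \<Rightarrow> bool" where
  "intrinsically_ergodic M T \<longleftrightarrow> (\<exists>!\<mu>. measure_of_maximal_entropy M T \<mu>)"

section \<open>Induced transformations\<close>

text \<open>
  The return time has a meaningful value only at points that return to \<open>A\<close>. For the map below
  and \<open>1 < \<beta> < (1 + sqrt 5) / 2\<close> every point of the inducing set returns.
\<close>

definition return_time :: "('a \<Rightarrow> 'a) \<Rightarrow> 'a set \<Rightarrow> 'a \<Rightarrow> nat" where
  "return_time T A p = (LEAST k. 1 \<le> k \<and> (T ^^ k) p \<in> A)"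

definition induced_map :: "('a \<Rightarrow> 'a) \<Rightarrow> 'a set \<Rightarrow> 'a \<Rightarrow> 'a" where
  "induced_map T A p = (T ^^ return_time T A p) p"

section \<open>The shrinking random beta-transformation\<close>

text \<open>
  The digits 0 and 1 are coded by \<^const>\<open>False\<close> and \<^const>\<open>True\<close>, and sequences are
  indexed from 0, so the first digit \<open>\<omega>\<^sub>1\<close> is \<open>of_bool (\<omega> 0)\<close>.
\<close>

definition Omega :: "(nat \<Rightarrow> bool) measure" where
  "Omega = Pi\<^sub>M UNIV (\<lambda>_. count_space UNIV)"

definition shift :: "(nat \<Rightarrow> bool) \<Rightarrow> nat \<Rightarrow> bool" where
  "shift \<omega> = (\<lambda>i. \<omega> (Suc i))"

definition switch_left :: "real \<Rightarrow> real" where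
  "switch_left \<beta> = 1 / (\<beta>\<^sup>2 - 1)"

definition switch_right :: "real \<Rightarrow> real" where
  "switch_right \<beta> = \<beta> / (\<beta>\<^sup>2 - 1)"

text \<open>
  The domain of the map is \<open>\<Omega> \<times> {0..1 / (\<beta> - 1)}\<close>, which it maps into itself for
  \<open>1 < \<beta> \<le> (1 + sqrt 5) / 2\<close>; the values of the total function below at other points
  then play no role.
\<close>

definition K :: "real \<Rightarrow> (nat \<Rightarrow> bool) \<times> real \<Rightarrow> (nat \<Rightarrow> bool) \<times> real" where
  "K \<beta> = (\<lambda>(\<omega>, x).
     if x < switch_left \<beta> then (\<omega>, \<beta> * x)
     else if x \<le> switch_right \<beta> then (shift \<omega>, \<beta> * x - of_bool (\<omega> 0))
     else (\<omega>, \<beta> * x - 1))"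

definition switch_space :: "real \<Rightarrow> ((nat \<Rightarrow> bool) \<times> real) measure" where
  "switch_space \<beta> =
     Omega \<Otimes>\<^sub>M restrict_space borel {switch_left \<beta>..switch_right \<beta>}"

definition induced_K :: "real \<Rightarrow> (nat \<Rightarrow> bool) \<times> real \<Rightarrow> (nat \<Rightarrow> bool) \<times> real" where
  "induced_K \<beta> = induced_map (K \<beta>) (UNIV \<times> {switch_left \<beta>..switch_right \<beta>})"

end

theory Submission
  imports Defs
begin

text \<open>
  Write \<open>m = n - 1\<close>. The equation for \<open>\<beta>\<close> says \<open>\<beta>\<^sup>m (b - 1) = a\<close>, so up to end points each digit
  \<open>\<omega>\<^sub>1\<close> splits \<open>[a, b]\<close> into \<open>m\<close> intervals, each of which the induced map carries affinely onto
  \<open>[a, b]\<close>: the map is a full shift on \<open>2 m\<close> symbols, except on \<open>Z = \<Omega> \<times> {a, b}\<close>. The set \<open>Z\<close>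
  satisfies \<open>I Z \<subseteq> Z\<close>, so an orbit of an invariant measure almost surely stays inside or outside \<open>Z\<close>.
  Labels that also mark the end points therefore generate, and counting words (at most
  \<open>2\<^sup>k\<^sup>+\<^sup>1\<close> of length \<open>k\<close> on \<open>Z\<close>, \<open>(2 m)\<^sup>k\<close> off \<open>Z\<close>) bounds the entropy by
  \<open>(1 - \<mu> Z) ln (2 m) + \<mu> Z ln 2\<close>. Equality with \<open>ln (2 m)\<close> forces \<open>\<mu> Z = 0\<close> and, as the entropy
  rate is the infimum of the normalised word entropies, uniform word distributions; so \<open>\<mu>\<close> is the
  image of the uniform Bernoulli measure under the decoding map.
\<close>

section \<open>Entropy of a measurable labelling\<close>

text \<open>Why there are \<open>m\<close> intervals: digit 1 sends \<open>[a, b]\<close> to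
  \<open>[b - 1, a]\<close>, and the orbit is then multiplied by \<beta> until it re-enters
  \<open>[a, b]\<close>. Since \<open>b = \<beta> * a\<close> and
  \<open>b - 1 = a / \<beta> ^ m\<close>, the intervals \<open>[a, b)\<close> divided by
  \<open>\<beta> ^ k\<close>, k = 1, ..., m, tile \<open>[b - 1, a)\<close> exactly; the k-th one
  has return time \<open>k + 1\<close>. Digit 0 follows by reflecting x to \<open>a + b - x\<close>
  and exchanging the digits. The obstacle is the end points, where adjacent branches meet.
  \<open>Z\<close> cannot be dismissed as negligible: the induced map acts on it by reading off
  digits, so it carries invariant measures of entropy \<open>ln 2\<close>. Nor is it completely
  invariant, since interior points can be mapped into it; these are removed only because
  \<open>Z\<close> and its preimage have equal measure. The strict gap between \<open>ln 2\<close>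
  and \<open>ln (2 m)\<close> comes from \<open>m \<ge> 2\<close>. Entropy is handled through
  labelling functions instead of partitions. That a labelling generates is expressed by a measurable
  map recovering almost every point from its itinerary.\<close>

lemma fekete:
  fixes u :: "nat \<Rightarrow> real"
  assumes sub: "\<And>m k. u (m + k) \<le> u m + u k" and nn: "\<And>m. 0 \<le> u m"
  obtains L where "(\<lambda>k. u k / real k) \<longlonglongrightarrow> L" "\<And>k. k \<ge> 1 \<Longrightarrow> L \<le> u k / real k"
proof -
  define S where "S = (\<lambda>k. u k / real k) ` {1..}"
  \<comment> \<open>Fekete's lemma with the limit identified as the infimum. The resulting bound for
    every single \<open>k\<close> is what later turns a maximal entropy rate into maximal entropy of
    the words of each length.\<close>
  define L where "L = Inf S"
  have bdd: "bdd_below S"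
    by (rule bdd_belowI[of _ 0]) (auto simp: S_def nn)
  have lower: "L \<le> u k / real k" if "k \<ge> 1" for k
    unfolding L_def using that by (intro cInf_lower[OF _ bdd]) (auto simp: S_def)
  have mult: "u (q * k + r) \<le> real q * u k + u r" for q k r
  proof (induction q)
    case (Suc q)
    have "u (Suc q * k + r) \<le> u k + u (q * k + r)"
      using sub[of k "q * k + r"] by (simp add: algebra_simps)
    with Suc show ?case by (simp add: algebra_simps)
  qed simp
  have "(\<lambda>k. u k / real k) \<longlonglongrightarrow> L"
  proof (rule LIMSEQ_I)
    fix e :: real assume e: "0 < e"
    have "S \<noteq> {}" by (auto simp: S_def)
    moreover have "Inf S < L + e / 2" using e by (simp add: L_def)
    ultimately obtain y where "y \<in> S" "y < L + e / 2"
      using cInf_lessD by metis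
    then obtain k where k: "k \<ge> 1" "u k / real k < L + e / 2" by (auto simp: S_def)
    \<comment> \<open>\<open>C\<close> dominates \<open>u\<close> at every possible remainder modulo
      \<open>k\<close>; being independent of \<open>n\<close>, it is absorbed by the choice of
      \<open>N\<close>.\<close>
    define C where "C = (\<Sum>r<k. u r)"
    have C: "u r \<le> C" if "r < k" for r
      unfolding C_def using that by (intro member_le_sum) (auto simp: nn)
    have C0: "0 \<le> C" by (auto simp: C_def nn intro: sum_nonneg)
    obtain N :: nat where N: "2 * C / e < real N" using reals_Archimedean2 by blast
    show "\<exists>N. \<forall>n\<ge>N. norm (u n / real n - L) < e"
    proof (intro exI allI impI)
      fix n assume n: "n \<ge> Suc N"
      define q r where "q = n div k" and "r = n mod k"
      have nqr: "n = q * k + r" and r: "r < k" using k by (auto simp: q_def r_def)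
      have "u n \<le> real q * u k + C" using mult[of q k r] C[OF r] nqr by simp
      also have "real q * u k \<le> (real q * real k) * (u k / real k)" using k by simp
      also have "\<dots> \<le> real n * (u k / real k)"
      proof (rule mult_right_mono)
        show "real q * real k \<le> real n"
          by (metis nqr le_add1 of_nat_le_iff of_nat_mult)
      qed (simp add: nn)
      also have "\<dots> \<le> real n * (L + e / 2)" using k(2) by (intro mult_left_mono) auto
      finally have "u n \<le> real n * (L + e / 2) + C" by simp
      moreover have "C < real n * (e / 2)"
      proof -
        have "2 * C / e < real n" using N n by linarith
        thus ?thesis using e by (simp add: field_simps)
      qed
      ultimately have "u n < real n * (L + e)" by (simp add: algebra_simps)
      hence "u n / real n < L + e" using n by (simp add: field_simps)
      moreover have "L \<le> u n / real n" using lower[of n] n by simp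
      ultimately show "norm (u n / real n - L) < e" using e by simp
    qed
  qed
  with lower that show thesis by blast
qed

text \<open>Shannon entropy, in nats, of the law of \<open>X\<close>. With labelling functions in
  place of partitions, joins become pairs and words, and the information theory of the library
  applies with base \<open>exp 1\<close>.\<close>

definition fun_entropy :: "'a measure \<Rightarrow> ('a \<Rightarrow> 'b) \<Rightarrow> real" where
  "fun_entropy M X = - (\<Sum>v\<in>X ` space M.
     measure M (X -` {v} \<inter> space M) * ln (measure M (X -` {v} \<inter> space M)))"

lemma fun_entropy_cong:
  assumes "\<And>x. x \<in> space M \<Longrightarrow> X x = Y x"
  shows "fun_entropy M X = fun_entropy M Y"
proof -
  have "X ` space M = Y ` space M" using assms by auto
  moreover have "X -` {v} \<inter> space M = Y -` {v} \<inter> space M" for v using assms by auto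
  ultimately show ?thesis by (simp add: fun_entropy_def)
qed

section \<open>Shannon entropy inequalities for finite-valued functions\<close>

context prob_space
begin

lemma fun_entropy_eq_entropy:
  assumes "simple_function M X"
  shows "fun_entropy M X = entropy (exp 1) (count_space (X ` space M)) X"
proof -
  interpret information_space M "exp 1" by unfold_locales simp
  show ?thesis
    using entropy_simple_distributed[OF simple_distributedI[OF assms measure_nonneg refl]]
    by (simp add: fun_entropy_def log_def)
qed

lemma fun_entropy_image_le:
  assumes X: "simple_function M X" and Y: "\<And>x. x \<in> space M \<Longrightarrow> Y x = g (X x)"
  shows "fun_entropy M Y \<le> fun_entropy M X"
proof -
  interpret information_space M "exp 1" by unfold_locales simp
  have "fun_entropy M Y = fun_entropy M (g \<circ> X)" using Y by (intro fun_entropy_cong) auto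
  also have "\<dots> \<le> fun_entropy M X"
    using entropy_data_processing[OF X, of g]
    by (simp add: fun_entropy_eq_entropy X simple_function_compose)
  finally show ?thesis .
qed

lemma fun_entropy_subadditive:
  assumes X: "simple_function M X" and Y: "simple_function M Y"
  shows "fun_entropy M (\<lambda>x. (X x, Y x)) \<le> fun_entropy M X + fun_entropy M Y"
proof -
  interpret information_space M "exp 1" by unfold_locales simp
  show ?thesis
    using entropy_chain_rule[OF X Y] conditional_entropy_less_eq_entropy[OF Y X]
    by (simp add: fun_entropy_eq_entropy X Y simple_function_Pair)
qed

lemma fun_entropy_nonneg: "0 \<le> fun_entropy M X"
proof -
  have "measure M A * ln (measure M A) \<le> 0" for A
    by (cases "measure M A = 0")
      (auto simp: mult_nonneg_nonpos measure_nonneg zero_less_measure_iff)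
  thus ?thesis by (simp add: fun_entropy_def sum_nonpos)
qed

lemma prob_compose_eq_sum:
  assumes X: "simple_function M X"
  shows "prob ((\<lambda>x. g (X x)) -` {v} \<inter> space M) =
    (\<Sum>w\<in>{w \<in> X ` space M. g w = v}. prob (X -` {w} \<inter> space M))"
proof -
  have "(\<lambda>x. g (X x)) -` {v} \<inter> space M
      = (\<Union>w\<in>{w \<in> X ` space M. g w = v}. X -` {w} \<inter> space M)" by auto
  also have "prob \<dots> = (\<Sum>w\<in>{w \<in> X ` space M. g w = v}. prob (X -` {w} \<inter> space M))"
    using X by (intro finite_measure_finite_Union)
      (auto simp: simple_functionD(1) simple_functionD(2) disjoint_family_on_def)
  finally show ?thesis .
qed

text \<open>Summing over the values of \<open>X\<close> instead of those of \<open>g\<close> after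
  \<open>X\<close> brings all marginal entropies of a joint law to one index set, where they can be
  combined termwise.\<close>

lemma fun_entropy_compose:
  assumes X: "simple_function M X"
  shows "fun_entropy M (\<lambda>x. g (X x)) = - (\<Sum>w\<in>X ` space M. prob (X -` {w} \<inter> space M) *
     ln (prob ((\<lambda>x. g (X x)) -` {g w} \<inter> space M)))"
proof -
  let ?P = "\<lambda>v. prob ((\<lambda>x. g (X x)) -` {v} \<inter> space M)"
  have im: "(\<lambda>x. g (X x)) ` space M = g ` (X ` space M)" by auto
  have "(\<Sum>w\<in>X ` space M. prob (X -` {w} \<inter> space M) * ln (?P (g w)))
      = (\<Sum>v\<in>g ` X ` space M. \<Sum>w\<in>{w \<in> X ` space M. g w = v}.
           prob (X -` {w} \<inter> space M) * ln (?P (g w)))"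
    using X by (intro sum.image_gen) (simp add: simple_functionD(1))
  also have "\<dots> = (\<Sum>v\<in>g ` X ` space M. ?P v * ln (?P v))"
    unfolding prob_compose_eq_sum[OF X] sum_distrib_right
    by (intro sum.cong refl) auto
  finally show ?thesis unfolding fun_entropy_def im by simp
qed

text \<open>This is nonnegativity of the conditional mutual information of \<open>X\<close> and
  \<open>Y\<close> given \<open>Z\<close>, expanded into joint entropies.\<close>

lemma fun_entropy_strong_subadditive:
  assumes X: "simple_function M X" and Y: "simple_function M Y" and Z: "simple_function M Z"
  shows "fun_entropy M (\<lambda>x. (X x, Y x, Z x)) + fun_entropy M Z
     \<le> fun_entropy M (\<lambda>x. (X x, Z x)) + fun_entropy M (\<lambda>x. (Y x, Z x))"
proof -
  interpret information_space M "exp 1" by unfold_locales simp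
  note sd = simple_distributedI[OF _ measure_nonneg refl]
  let ?W = "\<lambda>x. (X x, Y x, Z x)"
  have W: "simple_function M ?W" using X Y Z by (intro simple_function_Pair)
  let ?p = "\<lambda>V v. prob (V -` {v} \<inter> space M)"
  \<comment> \<open>The logarithm splits only if all four probabilities are positive. The joint one
    is below each marginal, so either all are positive or the prefactor is 0.\<close>
  have ln_ratio: "?p ?W (x,y,z) *
      ln (?p ?W (x,y,z) / (?p (\<lambda>x. (X x, Z x)) (x,z) * (?p (\<lambda>x. (Y x, Z x)) (y,z) / ?p Z z)))
      = ?p ?W (x,y,z) * (ln (?p ?W (x,y,z)) - ln (?p (\<lambda>x. (X x, Z x)) (x,z))
          - ln (?p (\<lambda>x. (Y x, Z x)) (y,z)) + ln (?p Z z))" for x y z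
  proof (cases "?p ?W (x,y,z) = 0")
    case False
    hence "?p ?W (x,y,z) > 0" by (simp add: zero_less_measure_iff)
    moreover have "?p ?W (x,y,z) \<le> ?p (\<lambda>x. (X x, Z x)) (x,z)"
      "?p ?W (x,y,z) \<le> ?p (\<lambda>x. (Y x, Z x)) (y,z)" "?p ?W (x,y,z) \<le> ?p Z z"
      using X Y Z by (auto intro!: finite_measure_mono simple_functionD(2) simple_function_Pair)
    ultimately show ?thesis
      by (simp add: ln_div ln_mult)
  qed simp
  have "0 \<le> conditional_mutual_information (exp 1) (count_space (X ` space M))
      (count_space (Y ` space M)) (count_space (Z ` space M)) X Y Z" by (rule conditional_mutual_information_nonneg[OF X Y Z])
  also have "\<dots> = (\<Sum>(x, y, z)\<in>?W ` space M. ?p ?W (x,y,z) *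
      (ln (?p ?W (x,y,z)) - ln (?p (\<lambda>x. (X x, Z x)) (x,z)) - ln (?p (\<lambda>x. (Y x, Z x)) (y,z)) + ln (?p Z z)))"
    by (subst conditional_mutual_information_eq[OF sd[OF Z] sd[OF simple_function_Pair[OF Y Z]]
          sd[OF simple_function_Pair[OF X Z]] sd[OF W]])
      (simp only: log_def ln_exp div_by_1 ln_ratio)
  also have "\<dots> = - fun_entropy M ?W + fun_entropy M (\<lambda>x. (X x, Z x))
      + fun_entropy M (\<lambda>x. (Y x, Z x)) - fun_entropy M Z"
    using fun_entropy_compose[OF W, of "\<lambda>x. x"] fun_entropy_compose[OF W, of "\<lambda>(x,y,z). (x,z)"]
      fun_entropy_compose[OF W, of "\<lambda>(x,y,z). (y,z)"] fun_entropy_compose[OF W, of "\<lambda>(x,y,z). z"]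
    by (simp add: case_prod_unfold algebra_simps sum.distrib sum_subtractf)
  finally show ?thesis by simp
qed


lemma fun_entropy_eqI:
  assumes X: "simple_function M X" and Y: "\<And>x. x \<in> space M \<Longrightarrow> Y x = g (X x)"
    and inv: "\<And>x. x \<in> space M \<Longrightarrow> X x = h (Y x)"
  shows "fun_entropy M Y = fun_entropy M X"
proof (rule antisym)
  show "fun_entropy M Y \<le> fun_entropy M X" using X Y by (rule fun_entropy_image_le)
  have "simple_function M (g \<circ> X)" using X by (rule simple_function_compose)
  hence "simple_function M Y" using Y by (subst simple_function_cong[of _ _ "g \<circ> X"]) auto
  thus "fun_entropy M X \<le> fun_entropy M Y" using inv by (rule fun_entropy_image_le)
qed

text \<open>
  On an atom \<open>{R = r}\<close> inside the approximant \<open>R\<^sup>-\<^sup>1 (C v)\<close> the summand is estimated by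
  \<open>p ln (s/p) \<le> s - p\<close>, outside it by \<open>p ln (s/p) \<le> p0 s + p ln (1/p0)\<close>.
\<close>

lemma conditional_fun_entropy_le:
  fixes p0 \<delta> :: real
  assumes Q: "simple_function M Q" and R: "simple_function M R" and p0: "0 < p0" "p0 \<le> 1"
    and approx: "\<And>v. v \<in> Q ` space M \<Longrightarrow>
      prob (((Q -` {v} - R -` C v) \<union> (R -` C v - Q -` {v})) \<inter> space M) \<le> \<delta>"
  shows "fun_entropy M (\<lambda>x. (Q x, R x)) - fun_entropy M R
     \<le> real (card (Q ` space M)) * (p0 + \<delta> * (1 + ln (1 / p0)))"
proof -
  let ?A = "Q ` space M" and ?B = "R ` space M"
  have fin: "finite ?A" "finite ?B" using Q R by (auto simp: simple_functionD(1))
  let ?QR = "\<lambda>x. (Q x, R x)"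
  have QR: "simple_function M ?QR" using Q R by (rule simple_function_Pair)
  define p where "p v r = prob (?QR -` {(v, r)} \<inter> space M)" for v r
  define s where "s r = prob (R -` {r} \<inter> space M)" for r
  have p_nn: "0 \<le> p v r" for v r by (simp add: p_def)
  have s_nn: "0 \<le> s r" for r by (simp add: s_def)
  have ps: "p v r \<le> s r" for v r
    unfolding p_def s_def using R by (intro finite_measure_mono) (auto simp: simple_functionD(2))
  have ext: "(\<Sum>w\<in>?QR ` space M. prob (?QR -` {w} \<inter> space M) * G w)
      = (\<Sum>v\<in>?A. \<Sum>r\<in>?B. p v r * G (v, r))" for G
  proof -
    have "(\<Sum>w\<in>?QR ` space M. prob (?QR -` {w} \<inter> space M) * G w)
        = (\<Sum>w\<in>?A \<times> ?B. prob (?QR -` {w} \<inter> space M) * G w)"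
    proof (rule sum.mono_neutral_left)
      show "\<forall>w\<in>?A \<times> ?B - ?QR ` space M. prob (?QR -` {w} \<inter> space M) * G w = 0"
      proof
        fix w assume "w \<in> ?A \<times> ?B - ?QR ` space M"
        hence "?QR -` {w} \<inter> space M = {}" by blast
        thus "prob (?QR -` {w} \<inter> space M) * G w = 0" by simp
      qed
    qed (use fin in auto)
    thus ?thesis by (simp add: sum.cartesian_product p_def case_prod_unfold)
  qed
  have "fun_entropy M ?QR - fun_entropy M R
      = (\<Sum>v\<in>?A. \<Sum>r\<in>?B. p v r * ln (s r)) - (\<Sum>v\<in>?A. \<Sum>r\<in>?B. p v r * ln (p v r))"
    using fun_entropy_compose[OF QR, of "\<lambda>w. w"] fun_entropy_compose[OF QR, of snd]
      ext[of "\<lambda>w. ln (prob (?QR -` {w} \<inter> space M))"]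
      ext[of "\<lambda>w. ln (prob (R -` {snd w} \<inter> space M))"]
    by (simp add: p_def s_def)
  also have "\<dots> = (\<Sum>v\<in>?A. \<Sum>r\<in>?B. p v r * (ln (s r) - ln (p v r)))"
    by (simp add: sum_subtractf algebra_simps)
  also have "\<dots> \<le> (\<Sum>v\<in>?A. p0 + \<delta> * (1 + ln (1 / p0)))"
  proof (rule sum_mono)
    fix v assume v: "v \<in> ?A"
    define L where "L = ln (1 / p0)"
    have L: "0 \<le> L" using p0 by (simp add: L_def)
    have inside: "p v r * (ln (s r) - ln (p v r)) \<le> s r - p v r" for r
    proof (cases "p v r = 0")
      case False
      hence pp: "0 < p v r" "0 < s r" using p_nn[of v r] ps[of v r] by auto
      hence "ln (s r) - ln (p v r) \<le> s r / p v r - 1"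
        using ln_le_minus_one[of "s r / p v r"] by (simp add: ln_div)
      hence "p v r * (ln (s r) - ln (p v r)) \<le> p v r * (s r / p v r - 1)"
        using pp by (intro mult_left_mono) auto
      thus ?thesis using pp by (simp add: right_diff_distrib)
    qed (simp add: s_nn)
    have outside: "p v r * (ln (s r) - ln (p v r)) \<le> p0 * s r + p v r * L" for r
    proof (cases "p v r = 0")
      case False
      hence pp: "0 < p v r" "0 < s r" using p_nn[of v r] ps[of v r] by auto
      hence "ln (s r) - ln (p v r) \<le> p0 * s r / p v r - 1 + L"
        using ln_le_minus_one[of "p0 * s r / p v r"] p0 by (simp add: ln_div ln_mult L_def)
      hence "p v r * (ln (s r) - ln (p v r)) \<le> p v r * (p0 * s r / p v r - 1 + L)"
        using pp by (intro mult_left_mono) auto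
      thus ?thesis using pp by (simp add: right_diff_distrib distrib_left)
    qed (use s_nn p0 in simp)
    have sum_p: "(\<Sum>r\<in>?B \<inter> D. p v r) = prob (Q -` {v} \<inter> R -` D \<inter> space M)" for D
    proof -
      have "Q -` {v} \<inter> R -` D \<inter> space M = (\<Union>r\<in>?B \<inter> D. ?QR -` {(v, r)} \<inter> space M)" by auto
      also have "prob \<dots> = (\<Sum>r\<in>?B \<inter> D. p v r)" unfolding p_def
        using QR fin by (intro finite_measure_finite_Union)
          (auto simp: simple_functionD(2) disjoint_family_on_def)
      finally show ?thesis by simp
    qed
    have sum_s: "(\<Sum>r\<in>?B \<inter> D. s r) = prob (R -` D \<inter> space M)" for D
    proof -
      have "R -` D \<inter> space M = (\<Union>r\<in>?B \<inter> D. R -` {r} \<inter> space M)" by auto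
      also have "prob \<dots> = (\<Sum>r\<in>?B \<inter> D. s r)" unfolding s_def
        using R fin by (intro finite_measure_finite_Union)
          (auto simp: simple_functionD(2) disjoint_family_on_def)
      finally show ?thesis by simp
    qed
    let ?D = "((Q -` {v} - R -` C v) \<union> (R -` C v - Q -` {v})) \<inter> space M"
    have meas: "Q -` E \<inter> space M \<in> events" "R -` E' \<inter> space M \<in> events" for E E'
      using Q R by (auto simp: simple_functionD(2))
    have Dm: "?D \<in> events"
    proof -
      have "?D = ((Q -` {v} \<inter> space M) - (R -` C v \<inter> space M))
         \<union> ((R -` C v \<inter> space M) - (Q -` {v} \<inter> space M))" by auto
      thus ?thesis using meas by auto
    qed
    have "(\<Sum>r\<in>?B. p v r * (ln (s r) - ln (p v r)))
        = (\<Sum>r\<in>?B \<inter> C v. p v r * (ln (s r) - ln (p v r)))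
        + (\<Sum>r\<in>?B \<inter> - C v. p v r * (ln (s r) - ln (p v r)))"
      using fin(2) by (subst sum.union_disjoint[symmetric]) (auto intro!: sum.cong)
    also have "\<dots> \<le> (\<Sum>r\<in>?B \<inter> C v. s r - p v r) + (\<Sum>r\<in>?B \<inter> - C v. p0 * s r + p v r * L)"
      by (intro add_mono sum_mono inside outside)
    also have "\<dots> = (prob (R -` C v \<inter> space M) - prob (Q -` {v} \<inter> R -` C v \<inter> space M))
        + (p0 * prob (R -` (- C v) \<inter> space M) + prob (Q -` {v} \<inter> R -` (- C v) \<inter> space M) * L)"
      by (simp add: sum_subtractf sum.distrib flip: sum_p sum_s sum_distrib_left sum_distrib_right)
    also have "prob (R -` C v \<inter> space M) - prob (Q -` {v} \<inter> R -` C v \<inter> space M)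
        = prob ((R -` C v \<inter> space M) - (Q -` {v} \<inter> R -` C v \<inter> space M))"
    proof (rule finite_measure_Diff[symmetric])
      have "Q -` {v} \<inter> R -` C v \<inter> space M = (Q -` {v} \<inter> space M) \<inter> (R -` C v \<inter> space M)" by auto
      thus "Q -` {v} \<inter> R -` C v \<inter> space M \<in> events" using meas by auto
    qed (use meas in auto)
    also have "\<dots> \<le> prob ?D" using Dm by (intro finite_measure_mono) auto
    also have "prob ?D \<le> \<delta>" using approx[OF v] .
    also have "p0 * prob (R -` (- C v) \<inter> space M) \<le> p0" using p0 by (simp add: mult_left_le)
    also have "prob (Q -` {v} \<inter> R -` (- C v) \<inter> space M) * L \<le> \<delta> * L"
    proof (rule mult_right_mono[OF _ L])
      have "prob (Q -` {v} \<inter> R -` (- C v) \<inter> space M) \<le> prob ?D"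
        using Dm by (intro finite_measure_mono) auto
      with approx[OF v] show "prob (Q -` {v} \<inter> R -` (- C v) \<inter> space M) \<le> \<delta>" by simp
    qed
    finally show "(\<Sum>r\<in>?B. p v r * (ln (s r) - ln (p v r))) \<le> p0 + \<delta> * (1 + ln (1 / p0))"
      by (simp add: L_def algebra_simps)
  qed
  finally show ?thesis by simp
qed

end

section \<open>Words along orbits and partitions into level sets\<close>

definition word :: "('a \<Rightarrow> 'a) \<Rightarrow> ('a \<Rightarrow> 'b) \<Rightarrow> nat \<Rightarrow> 'a \<Rightarrow> 'b list" where
  "word T f m x = map (\<lambda>i. f ((T ^^ i) x)) [0..<m]"

lemma length_word [simp]: "length (word T f m x) = m"
  by (simp add: word_def)

lemma word_0 [simp]: "word T f 0 x = []"
  by (simp add: word_def)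

lemma word_Suc: "word T f (Suc m) x = word T f m x @ [f ((T ^^ m) x)]"
  by (simp add: word_def)

lemma word_add: "word T f (m + k) x = word T f m x @ word T f k ((T ^^ m) x)"
proof (induction k)
  case (Suc k)
  have "(T ^^ (m + k)) x = (T ^^ k) ((T ^^ m) x)"
    by (metis add.commute comp_apply funpow_add)
  with Suc show ?case by (simp add: word_Suc)
qed simp

lemma nth_word [simp]: "i < m \<Longrightarrow> word T f m x ! i = f ((T ^^ i) x)"
  by (simp add: word_def)

definition fibres :: "'a measure \<Rightarrow> ('a \<Rightarrow> 'b) \<Rightarrow> 'a set set" where
  "fibres M f = (\<lambda>v. f -` {v} \<inter> space M) ` (f ` space M)"

lemma partition_entropy_fibres: "partition_entropy M (fibres M f) = fun_entropy M f"
proof -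
  have "inj_on (\<lambda>v. f -` {v} \<inter> space M) (f ` space M)"
    by (intro inj_onI) blast
  thus ?thesis
    by (simp add: partition_entropy_def fun_entropy_def fibres_def sum.reindex)
qed

lemma mem_fibres_iff: "A \<in> fibres M f \<longleftrightarrow> (\<exists>x\<in>space M. A = {y \<in> space M. f y = f x})"
  by (auto simp: fibres_def)

text \<open>A cell of the refinement is nonempty, so it contains some \<open>x\<close>, and then
  each block chosen for it must be the level set of \<open>g i\<close> through \<open>x\<close>. The
  condition \<open>m \<ge> 1\<close> excludes the empty intersection \<open>UNIV\<close>, which may
  exceed the space.\<close>

lemma common_refinement_fibres:
  assumes "m \<ge> 1"
  shows "common_refinement ((\<lambda>i. fibres M (g i)) ` {..<m}) = fibres M (\<lambda>x. map (\<lambda>i. g i x) [0..<m])"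
    (is "common_refinement ?P = ?F")
proof (intro set_eqI iffI)
  fix A assume "A \<in> common_refinement ?P"
  then obtain h where h: "h \<in> Pi ?P (\<lambda>P. P)" "A = \<Inter> (h ` ?P)" "A \<noteq> {}"
    unfolding common_refinement by blast
  then obtain x where x: "x \<in> A" by auto
  have eq: "x \<in> space M \<and> h (fibres M (g i)) = {y \<in> space M. g i y = g i x}" if "i < m" for i
  proof -
    have "h (fibres M (g i)) \<in> fibres M (g i)" using h(1) that by auto
    then obtain x' where "h (fibres M (g i)) = {y \<in> space M. g i y = g i x'}"
      unfolding mem_fibres_iff by blast
    moreover have "x \<in> h (fibres M (g i))" using x h(2) that by blast
    ultimately show ?thesis by simp
  qed
  have "A = {y \<in> space M. \<forall>i<m. g i y = g i x}"
  proof (intro set_eqI)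
    fix y
    have "y \<in> A \<longleftrightarrow> (\<forall>i<m. y \<in> h (fibres M (g i)))" unfolding h(2) by auto
    also have "\<dots> \<longleftrightarrow> (\<forall>i<m. y \<in> {y \<in> space M. g i y = g i x})" using eq by metis
    also have "\<dots> \<longleftrightarrow> y \<in> {y \<in> space M. \<forall>i<m. g i y = g i x}" using \<open>m \<ge> 1\<close> by auto
    finally show "y \<in> A \<longleftrightarrow> y \<in> {y \<in> space M. \<forall>i<m. g i y = g i x}" .
  qed
  moreover have "x \<in> space M" using eq[of 0] \<open>m \<ge> 1\<close> by auto
  ultimately show "A \<in> ?F" by (auto simp: mem_fibres_iff)
next
  fix A assume "A \<in> ?F"
  moreover have "(\<forall>i\<in>{0..<m}. g i y = g i x) \<longleftrightarrow> (\<forall>i<m. g i y = g i x)" for x y by auto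
  ultimately obtain x where x: "x \<in> space M" "A = {y \<in> space M. \<forall>i<m. g i y = g i x}"
    by (auto simp: mem_fibres_iff)
  \<comment> \<open>The choice is indexed by partitions, not by \<open>i\<close>, because the family
    is a set in which equal partitions coincide; choosing the block through \<open>x\<close> is
    consistent.\<close>
  define h where "h P = (SOME B. B \<in> P \<and> x \<in> B)" for P
  have h: "h (fibres M (g i)) = {y \<in> space M. g i y = g i x}" for i
    unfolding h_def using x(1) by (intro some_equality) (auto simp: mem_fibres_iff)
  have "A = \<Inter> (h ` ?P)"
  proof (intro set_eqI)
    fix y
    have "y \<in> \<Inter> (h ` ?P) \<longleftrightarrow> (\<forall>i<m. y \<in> {y \<in> space M. g i y = g i x})"
      by (auto simp: h)
    thus "y \<in> A \<longleftrightarrow> y \<in> \<Inter> (h ` ?P)" using x \<open>m \<ge> 1\<close> by auto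
  qed
  moreover have "h \<in> Pi ?P (\<lambda>P. P)" using x(1) by (auto simp: h mem_fibres_iff)
  moreover have "A \<noteq> {}" using x by auto
  ultimately show "A \<in> common_refinement ?P" unfolding common_refinement by blast
qed

lemma pullback_partition_fibres:
  assumes "T \<in> space M \<rightarrow> space M"
  shows "pullback_partition M T (fibres M f) = fibres M (\<lambda>x. f (T x))"
proof (intro set_eqI iffI)
  fix A assume "A \<in> pullback_partition M T (fibres M f)"
  then obtain B where B: "B \<in> fibres M f" "A = T -` B \<inter> space M" "A \<noteq> {}"
    unfolding pullback_partition_def by blast
  then obtain x y where "A = T -` {y \<in> space M. f y = f x} \<inter> space M" "y \<in> A"
    unfolding mem_fibres_iff by blast
  with assms show "A \<in> fibres M (\<lambda>x. f (T x))"
    unfolding mem_fibres_iff by (intro bexI[of _ y]) auto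
next
  fix A assume "A \<in> fibres M (\<lambda>x. f (T x))"
  then obtain x where x: "x \<in> space M" "A = {y \<in> space M. f (T y) = f (T x)}"
    by (auto simp: mem_fibres_iff)
  have "A = T -` {y \<in> space M. f y = f (T x)} \<inter> space M" using assms x by auto
  moreover have "{y \<in> space M. f y = f (T x)} \<in> fibres M f"
    unfolding mem_fibres_iff using assms x(1) by blast
  ultimately have "A \<in> (\<lambda>A. T -` A \<inter> space M) ` fibres M f" by (rule image_eqI)
  moreover have "x \<in> A" using x by simp
  ultimately show "A \<in> pullback_partition M T (fibres M f)"
    unfolding pullback_partition_def by blast
qed

lemma funpow_space:
  assumes "T \<in> space M \<rightarrow> space M"
  shows "(T ^^ i) \<in> space M \<rightarrow> space M"
  by (induction i) (use assms in auto)

lemma iterated_join_fibres: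
  assumes "T \<in> space M \<rightarrow> space M" "m \<ge> 1"
  shows "iterated_join M T m (fibres M f) = fibres M (word T f m)"
proof -
  have "iterated_join M T m (fibres M f)
      = common_refinement ((\<lambda>i. fibres M (\<lambda>x. f ((T ^^ i) x))) ` {..<m})"
    unfolding iterated_join_def
    by (simp add: pullback_partition_fibres[OF funpow_space[OF assms(1)]])
  thus ?thesis using assms(2) by (simp add: common_refinement_fibres word_def[abs_def])
qed

text \<open>Label each point by its own block. Thus a bound for all simple labellings is a bound for
  the supremum defining \<open>ks_entropy\<close>.\<close>

lemma finite_partition_eq_fibres:
  fixes M :: "'a measure"
  assumes "Q \<in> finite_partitions M"
  obtains q :: "'a \<Rightarrow> 'a set" where "simple_function M q" "fibres M q = Q"
proof -
  have Q: "finite Q" "Q \<subseteq> sets M" "partition_on (space M) Q"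
    using assms by (auto simp: finite_partitions_def)
  define q where "q x = (SOME A. A \<in> Q \<and> x \<in> A)" for x
  have q: "q x = A" if "x \<in> A" "A \<in> Q" for x A
    unfolding q_def using that Q(3)
    by (intro some_equality) (auto simp: partition_on_def disjoint_def)
  have ex: "\<exists>A\<in>Q. x \<in> A" if "x \<in> space M" for x
    using Q(3) that by (auto simp: partition_on_def)
  have sub: "A \<subseteq> space M" "A \<noteq> {}" if "A \<in> Q" for A
    using Q(3) that by (auto simp: partition_on_def)
  have im: "q ` space M = Q"
  proof (intro set_eqI iffI)
    fix A assume "A \<in> Q"
    moreover from this obtain x where "x \<in> A" using sub by blast
    ultimately show "A \<in> q ` space M" using q sub by (intro image_eqI[of _ _ x]) auto
  next
    fix A assume "A \<in> q ` space M"
    thus "A \<in> Q" using q ex by blast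
  qed
  have vim: "q -` {A} \<inter> space M = A" if "A \<in> Q" for A
    using q[OF _ that] ex q sub[OF that] by blast
  have sf: "simple_function M q"
    unfolding simple_function_def im using Q(1,2) vim by auto
  have "fibres M q = Q"
    unfolding fibres_def im using vim by simp
  with sf show thesis by (rule that)
qed

lemma fibres_finite_partitions:
  assumes "simple_function M f"
  shows "fibres M f \<in> finite_partitions M"
  using assms simple_functionD[OF assms]
  by (auto simp: finite_partitions_def fibres_def partition_on_def disjoint_def)

section \<open>Entropy rate of a measure-preserving map\<close>

locale mpt = prob_space +
  fixes T
  assumes T_meas [measurable]: "T \<in> M \<rightarrow>\<^sub>M M" and T_inv: "distr M M T = M"
begin

lemma T_space: "T \<in> space M \<rightarrow> space M"
  using T_meas by (rule measurable_space[THEN funcsetI])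

lemma T_pow_meas [measurable]: "T ^^ i \<in> M \<rightarrow>\<^sub>M M"
  by (induction i) (simp_all add: measurable_comp)

lemma T_pow_inv: "distr M M (T ^^ i) = M"
proof (induction i)
  case (Suc i)
  have "distr M M (T ^^ Suc i) = distr (distr M M (T ^^ i)) M T"
    by (subst distr_distr) auto
  thus ?case by (simp only: Suc T_inv)
qed (simp add: distr_id)

lemma prob_pow: "A \<in> sets M \<Longrightarrow> prob ((T ^^ i) -` A \<inter> space M) = prob A"
  by (metis T_pow_inv T_pow_meas measure_distr)

lemma AE_pow: "AE x in M. P x \<Longrightarrow> AE x in M. P ((T ^^ i) x)"
  using AE_distrD[of "T ^^ i" M M P] T_pow_inv T_pow_meas by metis

lemma simple_function_pow:
  assumes "simple_function M f"
  shows "simple_function M (\<lambda>x. f ((T ^^ i) x))"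
proof -
  have sub: "(\<lambda>x. f ((T ^^ i) x)) ` space M \<subseteq> f ` space M"
    using funpow_space[OF T_space, of i] by auto
  have "(\<lambda>x. f ((T ^^ i) x)) -` {v} \<inter> space M \<in> sets M" for v
  proof -
    have "(\<lambda>x. f ((T ^^ i) x)) -` {v} \<inter> space M = (T ^^ i) -` (f -` {v} \<inter> space M) \<inter> space M"
      using funpow_space[OF T_space, of i] by auto
    thus ?thesis using measurable_sets[OF T_pow_meas simple_functionD(2)[OF assms]] by (simp only:)
  qed
  with finite_subset[OF sub simple_functionD(1)[OF assms]] show ?thesis
    by (simp add: simple_function_def)
qed

lemma fun_entropy_pow:
  assumes f: "simple_function M f"
  shows "fun_entropy M (\<lambda>x. f ((T ^^ i) x)) = fun_entropy M f"
proof -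
  have sub: "(\<lambda>x. f ((T ^^ i) x)) ` space M \<subseteq> f ` space M"
    using funpow_space[OF T_space, of i] by auto
  have p: "prob ((\<lambda>x. f ((T ^^ i) x)) -` {v} \<inter> space M) = prob (f -` {v} \<inter> space M)" for v
  proof -
    have "(\<lambda>x. f ((T ^^ i) x)) -` {v} \<inter> space M = (T ^^ i) -` (f -` {v} \<inter> space M) \<inter> space M"
      using funpow_space[OF T_space, of i] by auto
    thus ?thesis using prob_pow[OF simple_functionD(2)[OF f]] by (simp only:)
  qed
  \<comment> \<open>Composition with the power of \<open>T\<close> may lose values of
    \<open>f\<close>, but only values of probability 0.\<close>
  have "prob (f -` {v} \<inter> space M) = 0" if "v \<notin> (\<lambda>x. f ((T ^^ i) x)) ` space M" for v
  proof -
    have "(\<lambda>x. f ((T ^^ i) x)) -` {v} \<inter> space M = {}" using that by blast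
    with p[of v] show ?thesis by simp
  qed
  thus ?thesis unfolding fun_entropy_def p
    using sub simple_functionD(1)[OF f]
    by (intro arg_cong[of _ _ uminus] sum.mono_neutral_left) auto
qed

lemma simple_function_word: "simple_function M f \<Longrightarrow> simple_function M (word T f m)"
proof (induction m)
  case (Suc m)
  have "simple_function M ((\<lambda>(u, v). u @ [v]) \<circ> (\<lambda>x. (word T f m x, f ((T ^^ m) x))))"
    using Suc by (intro simple_function_compose simple_function_Pair simple_function_pow) auto
  thus ?case by (simp add: comp_def word_Suc[abs_def])
qed (simp add: word_def[abs_def])

lemma fun_entropy_word_subadditive:
  assumes f: "simple_function M f"
  shows "fun_entropy M (word T f (m + k)) \<le> fun_entropy M (word T f m) + fun_entropy M (word T f k)"
proof -
  have sf: "simple_function M (word T f m)" "simple_function M (\<lambda>x. word T f k ((T ^^ m) x))"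
    by (intro simple_function_pow simple_function_word f)+
  have "fun_entropy M (word T f (m + k))
      \<le> fun_entropy M (\<lambda>x. (word T f m x, word T f k ((T ^^ m) x)))"
    by (rule fun_entropy_image_le[where g = "\<lambda>(u, v). u @ v"])
      (auto simp: word_add intro: simple_function_Pair sf)
  also have "\<dots> \<le> fun_entropy M (word T f m) + fun_entropy M (\<lambda>x. word T f k ((T ^^ m) x))"
    by (intro fun_entropy_subadditive sf)
  finally show ?thesis by (simp add: fun_entropy_pow simple_function_word f)
qed

definition fun_rate :: "('a \<Rightarrow> 'b) \<Rightarrow> real" where
  "fun_rate f = lim (\<lambda>m. fun_entropy M (word T f m) / real m)"

lemma
  assumes f: "simple_function M f"
  shows fun_rate_LIMSEQ: "(\<lambda>m. fun_entropy M (word T f m) / real m) \<longlonglongrightarrow> fun_rate f"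
    and fun_rate_le: "m \<ge> 1 \<Longrightarrow> fun_rate f \<le> fun_entropy M (word T f m) / real m"
proof -
  obtain L where "(\<lambda>m. fun_entropy M (word T f m) / real m) \<longlonglongrightarrow> L"
    "\<And>k. k \<ge> 1 \<Longrightarrow> L \<le> fun_entropy M (word T f k) / real k"
    using fekete[of "\<lambda>m. fun_entropy M (word T f m)"]
      fun_entropy_word_subadditive[OF f] fun_entropy_nonneg by metis
  thus "(\<lambda>m. fun_entropy M (word T f m) / real m) \<longlonglongrightarrow> fun_rate f"
    "m \<ge> 1 \<Longrightarrow> fun_rate f \<le> fun_entropy M (word T f m) / real m"
    by (auto simp: fun_rate_def limI)
qed

lemma entropy_wrt_fibres:
  assumes f: "simple_function M f"
  shows "entropy_wrt_partition M T (fibres M f) = fun_rate f"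
proof -
  have "eventually (\<lambda>m. fun_entropy M (word T f m) / real m
      = partition_entropy M (iterated_join M T m (fibres M f)) / real m) sequentially"
    using eventually_ge_at_top[of 1]
    by eventually_elim (simp add: iterated_join_fibres[OF T_space] partition_entropy_fibres)
  from Lim_transform_eventually[OF fun_rate_LIMSEQ[OF f] this]
  show ?thesis unfolding entropy_wrt_partition_def by (rule limI)
qed

lemma fun_rate_le_ks_entropy:
  assumes "simple_function M f"
  shows "ereal (fun_rate f) \<le> ks_entropy M T"
  unfolding ks_entropy_def entropy_wrt_fibres[OF assms, symmetric]
  by (intro SUP_upper fibres_finite_partitions assms)

text \<open>The increment per letter is the conditional entropy of \<open>Q\<close> given
  \<open>R\<close>: by the chain rule, conditioning on more data lowers entropy, and by stationarity
  each of the \<open>m\<close> letters costs the same.\<close>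

lemma fun_entropy_words_le:
  assumes Q: "simple_function M Q" and R: "simple_function M R"
  shows "fun_entropy M (word T Q m) \<le> fun_entropy M (word T R m)
     + real m * (fun_entropy M (\<lambda>x. (Q x, R x)) - fun_entropy M R)"
proof -
  define c where "c = fun_entropy M (\<lambda>x. (Q x, R x)) - fun_entropy M R"
  have "fun_entropy M (\<lambda>x. (word T Q m x, word T R m x)) \<le> fun_entropy M (word T R m) + real m * c"
  proof (induction m)
    case 0
    have "fun_entropy M (\<lambda>x. (word T Q 0 x, word T R 0 x)) \<le> fun_entropy M (word T R 0)"
      by (rule fun_entropy_image_le[where g = "\<lambda>_. ([], [])"]) (auto intro: simple_function_word R)
    thus ?case by (simp only: of_nat_0 mult_zero_left add_0_right)
  next
    case (Suc m)
    let ?Q = "word T Q m" and ?R = "word T R m"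
      and ?q = "\<lambda>x. Q ((T ^^ m) x)" and ?r = "\<lambda>x. R ((T ^^ m) x)"
    have sf: "simple_function M ?Q" "simple_function M ?R" "simple_function M ?q" "simple_function M ?r"
      by (intro simple_function_pow simple_function_word Q R)+
    have sfQR: "simple_function M (\<lambda>x. (?Q x, ?R x))" using sf by (intro simple_function_Pair)
    have "fun_entropy M (\<lambda>x. (word T Q (Suc m) x, word T R (Suc m) x))
        \<le> fun_entropy M (\<lambda>x. ((?Q x, ?R x), ?q x, ?r x))"
      by (rule fun_entropy_image_le[where g = "\<lambda>((u, v), a, b). (u @ [a], v @ [b])"])
        (use sf in \<open>auto simp: word_Suc intro!: simple_function_Pair\<close>)
    \<comment> \<open>First use of strong subadditivity: the new letter of \<open>Q\<close> costs at
      most its entropy given the new letter of \<open>R\<close> alone.\<close>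
    also have "\<dots> \<le> fun_entropy M (\<lambda>x. ((?Q x, ?R x), ?r x)) + fun_entropy M (\<lambda>x. (?q x, ?r x))
        - fun_entropy M ?r"
      using fun_entropy_strong_subadditive[OF sfQR sf(3,4)] by simp
    also have "fun_entropy M (\<lambda>x. (?q x, ?r x)) = fun_entropy M (\<lambda>x. (Q x, R x))"
      using fun_entropy_pow[OF simple_function_Pair[OF Q R]] by simp
    also have "fun_entropy M ?r = fun_entropy M R" by (rule fun_entropy_pow[OF R])
    also have "fun_entropy M (\<lambda>x. ((?Q x, ?R x), ?r x)) = fun_entropy M (\<lambda>x. (?Q x, ?r x, ?R x))"
      by (rule fun_entropy_eqI[where g = "\<lambda>(u, b, v). ((u, v), b)" and h = "\<lambda>((u, v), b). (u, b, v)"])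
        (use sf in \<open>auto intro!: simple_function_Pair\<close>)
    \<comment> \<open>Second use: the new letter of \<open>R\<close> costs at most its entropy given
      the earlier \<open>R\<close>-word, so the \<open>R\<close> terms telescope to the word of
      length \<open>Suc m\<close>.\<close>
    also have "\<dots> \<le> fun_entropy M (\<lambda>x. (?Q x, ?R x)) + fun_entropy M (\<lambda>x. (?r x, ?R x)) - fun_entropy M ?R"
      using fun_entropy_strong_subadditive[OF sf(1,4,2)] by simp
    also have "fun_entropy M (\<lambda>x. (?r x, ?R x)) = fun_entropy M (word T R (Suc m))"
      by (rule fun_entropy_eqI[where h = "\<lambda>(b, v). v @ [b]" and g = "\<lambda>v. (last v, butlast v)"])
        (use simple_function_word[OF R] in \<open>auto simp: word_Suc\<close>)
    finally show ?case using Suc by (simp add: c_def algebra_simps)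
  qed
  moreover have "fun_entropy M (word T Q m) \<le> fun_entropy M (\<lambda>x. (word T Q m x, word T R m x))"
    by (rule fun_entropy_image_le[where g = fst])
      (auto intro!: simple_function_Pair simple_function_word Q R)
  ultimately show ?thesis by (simp add: c_def)
qed

text \<open>Take for \<open>R\<close> the \<open>f\<close>-word of length \<open>k\<close>. The
  \<open>m\<close> overlapping windows of length \<open>k\<close> are all contained in one
  \<open>f\<close>-word of length \<open>m + k\<close>, and the \<open>k\<close> surplus letters
  vanish in the rate.\<close>

lemma fun_rate_le_conditional:
  assumes Q: "simple_function M Q" and f: "simple_function M f"
  shows "fun_rate Q \<le> fun_rate f
     + (fun_entropy M (\<lambda>x. (Q x, word T f k x)) - fun_entropy M (word T f k))"
proof -
  define R where "R = word T f k"
  define c where "c = fun_entropy M (\<lambda>x. (Q x, R x)) - fun_entropy M R"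
  have R: "simple_function M R" unfolding R_def by (intro simple_function_word f)
  have bound: "fun_entropy M (word T Q m) / real m
      \<le> fun_entropy M (word T f m) / real m + fun_entropy M R / real m + c" if m: "m \<ge> 1" for m
  proof -
    have "fun_entropy M (word T Q m) \<le> fun_entropy M (word T R m) + real m * c"
      using fun_entropy_words_le[OF Q R] by (simp add: c_def)
    also have "fun_entropy M (word T R m) \<le> fun_entropy M (word T f (m + k))"
    proof (rule fun_entropy_image_le)
      show "word T R m x = map (\<lambda>i. map (\<lambda>j. word T f (m + k) x ! (j + i)) [0..<k]) [0..<m]" for x
        by (simp add: R_def word_def funpow_add)
    qed (intro simple_function_word f)
    also have "\<dots> \<le> fun_entropy M (word T f m) + fun_entropy M R"
      unfolding R_def by (rule fun_entropy_word_subadditive[OF f])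
    finally show ?thesis using m by (simp add: field_simps)
  qed
  have "(\<lambda>m. fun_entropy M R * (1 / real m)) \<longlonglongrightarrow> fun_entropy M R * 0"
    by (intro tendsto_mult tendsto_const lim_1_over_n)
  hence z: "(\<lambda>m. fun_entropy M R / real m) \<longlonglongrightarrow> 0" by simp
  have "(\<lambda>m. fun_entropy M (word T f m) / real m + fun_entropy M R / real m + c) \<longlonglongrightarrow> fun_rate f + 0 + c"
    by (intro tendsto_add tendsto_const fun_rate_LIMSEQ f z)
  from LIMSEQ_le[OF fun_rate_LIMSEQ[OF Q] this] bound
  show ?thesis unfolding c_def R_def by auto
qed

end

section \<open>Itineraries and generators\<close>

definition seqs :: "(nat \<Rightarrow> 'b) measure" where
  "seqs = (\<Pi>\<^sub>M i\<in>UNIV. count_space UNIV)"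

abbreviation seq_take :: "nat \<Rightarrow> (nat \<Rightarrow> 'b) \<Rightarrow> 'b list" where
  "seq_take m s \<equiv> map s [0..<m]"

lemma space_seqs [simp]: "space seqs = UNIV"
  by (simp add: seqs_def space_PiM)

lemma measurable_seqs_component [measurable]: "(\<lambda>s. s i) \<in> seqs \<rightarrow>\<^sub>M count_space UNIV"
  unfolding seqs_def by measurable

lemma measurable_into_seqs:
  assumes "\<And>i. (\<lambda>x. g x i) \<in> M \<rightarrow>\<^sub>M count_space UNIV"
  shows "g \<in> M \<rightarrow>\<^sub>M seqs"
  unfolding seqs_def using measurable_PiM_single'[of UNIV "\<lambda>i x. g x i" M "\<lambda>_. count_space UNIV"] assms
  by simp

lemma seq_take_eq_iff: "seq_take m s = w \<longleftrightarrow> length w = m \<and> (\<forall>i<m. s i = w ! i)"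
  by (auto simp: list_eq_iff_nth_eq)

lemma measurable_seq_take [measurable]:
  "seq_take m \<in> (seqs :: (nat \<Rightarrow> 'b::countable) measure) \<rightarrow>\<^sub>M count_space UNIV"
proof (subst measurable_count_space_eq_countable, simp, intro conjI ballI)
  fix w :: "'b list"
  have "seq_take m -` {w} \<inter> space seqs = {s \<in> space seqs. length w = m \<and> (\<forall>i<m. s i = w ! i)}"
    by (auto simp: seq_take_eq_iff simp del: map_eq_conv)
  also have "\<dots> \<in> sets seqs" by measurable
  finally show "seq_take m -` {w} \<inter> space seqs \<in> sets seqs" .
qed simp

definition cylinder :: "nat \<Rightarrow> 'b list set \<Rightarrow> (nat \<Rightarrow> 'b) set" where
  "cylinder m C = seq_take m -` C"

lemma cylinder_coordinate: "cylinder (Suc i) {w. w ! i \<in> B} = {s. s i \<in> B}"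
  by (auto simp: cylinder_def simp del: upt_Suc)

lemma sets_cylinder [measurable]: "cylinder m C \<in> sets (seqs :: (nat \<Rightarrow> 'b::countable) measure)"
  using measurable_sets[OF measurable_seq_take, of C m] by (simp add: cylinder_def)

lemma sets_seqs:
  "sets (seqs :: (nat \<Rightarrow> 'b) measure) = sigma_sets UNIV {{s. s i \<in> A} | i A. True}"
  unfolding seqs_def sets_PiM_single by (simp add: PiE_UNIV_domain)

text \<open>The sets that cylinders approximate in measure are closed under complements and
  countable unions and contain the coordinate sets. For a union, finitely many members carry all but
  \<open>e / 2\<close> of the measure, and the other half of \<open>e\<close> is shared among
  them.\<close>

lemma cylinder_approximation:
  fixes M :: "(nat \<Rightarrow> 'b::countable) measure" and e :: real
  assumes "finite_measure M" and M: "sets M = sets seqs" and A: "A \<in> sets M" and e: "0 < e"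
  shows "\<exists>m C. measure M (sym_diff A (cylinder m C)) < e"
proof -
  interpret finite_measure M by fact
  have [measurable_cong]: "sets M = sets seqs" by (rule M)
  have "A \<in> sigma_sets UNIV {{s. s i \<in> A} | i A. True}" using A by (simp add: M sets_seqs)
  thus ?thesis using e
  proof (induction arbitrary: e)
    case (Basic a)
    then obtain i B where a: "a = {s. s i \<in> B}" by auto
    have "cylinder (Suc i) {w. w ! i \<in> B} = a" by (simp add: a cylinder_coordinate)
    hence "measure M (sym_diff a (cylinder (Suc i) {w. w ! i \<in> B})) < e"
      using Basic by simp
    thus ?case by blast
  next
    case Empty
    have "measure M (sym_diff {} (cylinder 0 {})) < e" using Empty by (simp add: cylinder_def)
    thus ?case by blast
  next
    case (Compl a)
    then obtain m C where "measure M (sym_diff a (cylinder m C)) < e" by blast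
    moreover have "sym_diff (UNIV - a) (cylinder m (- C)) = sym_diff a (cylinder m C)"
      by (auto simp: cylinder_def)
    ultimately have "measure M (sym_diff (UNIV - a) (cylinder m (- C))) < e" by simp
    thus ?case by blast
  next
    case (Union a)
    have a [measurable]: "a i \<in> sets M" for i
      using Union(1) by (simp add: M sets_seqs)
    let ?U = "\<lambda>k. \<Union>i<k. a i"
    have "(\<lambda>k. measure M (?U k)) \<longlonglongrightarrow> measure M (\<Union>k. ?U k)"
      by (intro finite_Lim_measure_incseq) (auto simp: incseq_def intro: less_le_trans)
    moreover have "(\<Union>k. ?U k) = (\<Union>i. a i)" by auto
    ultimately have "eventually (\<lambda>k. measure M (\<Union>i. a i) - e / 2 < measure M (?U k)) sequentially"
      using Union(3) by (intro order_tendstoD) auto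
    then obtain k where k: "measure M (\<Union>i. a i) - e / 2 < measure M (?U k)"
      by (auto simp: eventually_sequentially)
    \<comment> \<open>The denominator uses \<open>k + 1\<close> so that \<open>d\<close> stays
      positive for \<open>k = 0\<close>. Below, the sum of the lengths serves as a common length
      exceeding each of them.\<close>
    define d where "d = e / (2 * (real k + 1))"
    have "0 < d" using Union(3) by (simp add: d_def)
    then obtain mm CC where mC: "measure M (sym_diff (a i) (cylinder (mm i) (CC i))) < d" for i
      using Union(2) by metis
    define m where "m = sum mm {..<k}"
    define C where "C = (\<Union>i<k. {w. take (mm i) w \<in> CC i})"
    have mm: "mm i \<le> m" if "i < k" for i
      unfolding m_def using that by (intro member_le_sum) auto
    have cyl: "cylinder m C = (\<Union>i<k. cylinder (mm i) (CC i))"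
      using mm by (auto simp: cylinder_def C_def take_map)
    have "measure M (sym_diff (\<Union>i. a i) (cylinder m C))
        \<le> measure M (((\<Union>i. a i) - ?U k) \<union> (\<Union>i<k. sym_diff (a i) (cylinder (mm i) (CC i))))"
      unfolding cyl by (intro finite_measure_mono) auto
    also have "\<dots> \<le> measure M ((\<Union>i. a i) - ?U k)
        + measure M (\<Union>i<k. sym_diff (a i) (cylinder (mm i) (CC i)))"
      by (intro measure_Un_le) auto
    also have "measure M ((\<Union>i. a i) - ?U k) = measure M (\<Union>i. a i) - measure M (?U k)"
      by (intro finite_measure_Diff) auto
    also have "\<dots> < e / 2" using k by simp
    also have "measure M (\<Union>i<k. sym_diff (a i) (cylinder (mm i) (CC i)))
        \<le> (\<Sum>i<k. measure M (sym_diff (a i) (cylinder (mm i) (CC i))))"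
      by (intro finite_measure_subadditive_finite) auto
    also have "\<dots> \<le> (\<Sum>i<k. d)" by (intro sum_mono) (simp add: mC less_imp_le)
    also have "\<dots> \<le> e / 2" using Union(3) by (simp add: d_def field_simps)
    finally show ?case by auto
  qed
qed

text \<open>Words over a countable alphabet are countable, so agreement on single words extends to
  all cylinders, an intersection-stable generator.\<close>

lemma seqs_measure_eqI:
  fixes N N' :: "(nat \<Rightarrow> 'b::countable) measure"
  assumes N: "prob_space N" "sets N = sets seqs" and N': "prob_space N'" "sets N' = sets seqs"
    and eq: "\<And>m w. length w = m \<Longrightarrow> measure N (seq_take m -` {w}) = measure N' (seq_take m -` {w})"
  shows "N = N'"
proof -
  interpret N: prob_space N by fact
  interpret N': prob_space N' by fact
  have [measurable_cong]: "sets N = sets seqs" "sets N' = sets seqs" using N N' by auto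
  have sp: "space N = UNIV" "space N' = UNIV" using N(2)[THEN sets_eq_imp_space_eq] N'(2)[THEN sets_eq_imp_space_eq] by simp_all
  have cyl: "emeasure N (cylinder m C) = emeasure N' (cylinder m C)" for m C
  proof -
    have "distr N (count_space UNIV) (seq_take m) = distr N' (count_space UNIV) (seq_take m)"
    proof (rule measure_eqI_countable)
      fix w :: "'b list"
      have "emeasure N (seq_take m -` {w}) = emeasure N' (seq_take m -` {w})"
      proof (cases "length w = m")
        case True
        thus ?thesis using eq[OF True] by (simp add: N.emeasure_eq_measure N'.emeasure_eq_measure)
      next
        case False
        hence "seq_take m -` {w} = {}" by auto
        thus ?thesis by simp
      qed
      thus "emeasure (distr N (count_space UNIV) (seq_take m)) {w}
          = emeasure (distr N' (count_space UNIV) (seq_take m)) {w}"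
        by (simp add: emeasure_distr sp)
    qed auto
    hence "emeasure (distr N (count_space UNIV) (seq_take m)) C
        = emeasure (distr N' (count_space UNIV) (seq_take m)) C" by simp
    thus ?thesis by (simp add: emeasure_distr sp cylinder_def)
  qed
  show ?thesis
  proof (rule measure_eqI_generator_eq[where E = "{cylinder m C | m C. True}" and \<Omega> = UNIV
        and A = "\<lambda>_. cylinder 0 UNIV"])
    show "Int_stable {cylinder m C | m (C :: 'b list set). True}"
    proof (rule Int_stableI)
      fix a b assume "a \<in> {cylinder m C | m (C :: 'b list set). True}" "b \<in> {cylinder m C | m (C :: 'b list set). True}"
      then obtain m C m' C' where ab: "a = cylinder m C" "b = cylinder m' C'" by auto
      have "a \<inter> b = cylinder (m + m') {w. take m w \<in> C \<and> take m' w \<in> C'}"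
        by (auto simp: ab cylinder_def take_map)
      thus "a \<inter> b \<in> {cylinder m C | m C. True}" by auto
    qed
    have "sigma_sets UNIV {{s. s i \<in> A} | i A. True} = sigma_sets UNIV {cylinder m C | m (C :: 'b list set). True}"
    proof (rule antisym)
      show "sigma_sets UNIV {{s. s i \<in> A} | i A. True} \<subseteq> sigma_sets UNIV {cylinder m C | m (C :: 'b list set). True}"
      proof (intro sigma_sets_mono subsetI sigma_sets.Basic)
        fix a :: "(nat \<Rightarrow> 'b) set" assume "a \<in> {{s. s i \<in> A} | i A. True}"
        then obtain i B where "a = {s. s i \<in> B}" by auto
        hence "a = cylinder (Suc i) {w. w ! i \<in> B}" by (simp add: cylinder_coordinate)
        thus "a \<in> {cylinder m C | m C. True}" by blast
      qed
      have "{cylinder m C | m (C :: 'b list set). True} \<subseteq> sets seqs" by auto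
      thus "sigma_sets UNIV {cylinder m C | m (C :: 'b list set). True} \<subseteq> sigma_sets UNIV {{s. s i \<in> A} | i A. True}"
        using sets.sigma_sets_subset[of _ seqs] by (simp add: sets_seqs)
    qed
    thus "sets N = sigma_sets UNIV {cylinder m C | m C. True}"
      "sets N' = sigma_sets UNIV {cylinder m C | m C. True}"
      using N(2) N'(2) by (simp_all add: sets_seqs)
    show "\<And>X. X \<in> {cylinder m C | m C. True} \<Longrightarrow> emeasure N X = emeasure N' X"
      using cyl by auto
    show "range (\<lambda>_. cylinder 0 UNIV) \<subseteq> {cylinder m C | m C. True}" by auto
  qed (auto simp: cylinder_def)
qed

section \<open>The Kolmogorov-Sinai generator theorem\<close>

definition itinerary :: "('a \<Rightarrow> 'a) \<Rightarrow> ('a \<Rightarrow> 'b) \<Rightarrow> 'a \<Rightarrow> nat \<Rightarrow> 'b" where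
  "itinerary T f x = (\<lambda>i. f ((T ^^ i) x))"

lemma seq_take_itinerary [simp]: "seq_take m (itinerary T f x) = word T f m x"
  by (simp add: itinerary_def word_def)

context mpt
begin

lemma measurable_itinerary:
  assumes "f \<in> M \<rightarrow>\<^sub>M count_space UNIV"
  shows "itinerary T f \<in> M \<rightarrow>\<^sub>M seqs"
proof (rule measurable_into_seqs)
  have [measurable]: "f \<in> M \<rightarrow>\<^sub>M count_space UNIV" by fact
  show "(\<lambda>x. itinerary T f x i) \<in> M \<rightarrow>\<^sub>M count_space UNIV" for i
    unfolding itinerary_def by measurable
qed

text \<open>Up to a null set every block of \<open>Q\<close> is the itinerary preimage of a
  measurable set of sequences. That set is nearly a cylinder, so a long enough \<open>f\<close>-word
  almost determines \<open>Q\<close> and the conditional entropy of \<open>Q\<close> is at most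
  \<open>e\<close>.\<close>

theorem fun_rate_le_generator:
  fixes f :: "'a \<Rightarrow> 'b::countable" and Q :: "'a \<Rightarrow> 'c"
  assumes f: "simple_function M f" and dec [measurable]: "dec \<in> seqs \<rightarrow>\<^sub>M M"
    and inv: "AE x in M. dec (itinerary T f x) = x" and Q: "simple_function M Q"
  shows "fun_rate Q \<le> fun_rate f"
proof (rule field_le_epsilon)
  fix e :: real assume e: "0 < e"
  have [measurable]: "itinerary T f \<in> M \<rightarrow>\<^sub>M seqs"
    by (intro measurable_itinerary measurable_simple_function f)
  define N where "N = distr M seqs (itinerary T f)"
  interpret N: prob_space N unfolding N_def by (rule prob_space_distr) measurable
  have N: "sets N = sets seqs" by (simp add: N_def)
  define K where "K = real (card (Q ` space M)) + 1"
  have K: "K \<ge> 1" by (simp add: K_def)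
  \<comment> \<open>The target is \<open>K * (p0 + \<delta> * L) \<le> e\<close>, with
    \<open>e / 2\<close> for each summand. Since \<open>L\<close> depends on \<open>p0\<close>, the
    latter is fixed before \<delta>.\<close>
  define p0 where "p0 = min 1 (e / (2 * K))"
  have p0: "0 < p0" "p0 \<le> 1" "p0 \<le> e / (2 * K)" using e K by (auto simp: p0_def)
  define L where "L = 1 + ln (1 / p0)"
  have L: "L \<ge> 1" using p0 by (simp add: L_def)
  define \<delta> where "\<delta> = e / (2 * K * L)"
  have \<delta>: "0 < \<delta>" using e K L by (simp add: \<delta>_def)
  define A where "A v = dec -` (Q -` {v} \<inter> space M) \<inter> space seqs" for v
  have A [measurable]: "A v \<in> sets seqs" for v
    unfolding A_def by (intro measurable_sets[OF dec] simple_functionD(2)[OF Q])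
  have "\<exists>m C. measure N (sym_diff (A v) (cylinder m C)) < \<delta>" for v
    by (rule cylinder_approximation[OF N.finite_measure_axioms N _ \<delta>]) (simp add: N)
  then obtain mm CC where mC: "measure N (sym_diff (A v) (cylinder (mm v) (CC v))) < \<delta>" for v
    by metis
  define m where "m = sum mm (Q ` space M)"
  have mm: "mm v \<le> m" if "v \<in> Q ` space M" for v
    unfolding m_def using that Q by (intro member_le_sum) (auto simp: simple_functionD)
  let ?R = "word T f m" and ?C = "\<lambda>v. {w. take (mm v) w \<in> CC v}"
  have "prob (((Q -` {v} - ?R -` ?C v) \<union> (?R -` ?C v - Q -` {v})) \<inter> space M) \<le> \<delta>" (is "prob ?D \<le> _")
    if v: "v \<in> Q ` space M" for v
  proof -
    let ?S = "sym_diff (A v) (cylinder (mm v) (CC v))"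
    have tk: "take (mm v) (?R x) = word T f (mm v) x" for x
      using mm[OF v] by (simp add: word_def take_map)
    have "prob ?D \<le> prob (itinerary T f -` ?S \<inter> space M)"
    proof (rule finite_measure_mono_AE)
      show "AE x in M. x \<in> ?D \<longrightarrow> x \<in> itinerary T f -` ?S \<inter> space M"
        using inv AE_space
        by eventually_elim (auto simp: A_def cylinder_def tk)
      show "itinerary T f -` ?S \<inter> space M \<in> events" by measurable
    qed
    also have "\<dots> = measure N ?S" unfolding N_def by (subst measure_distr) auto
    also have "\<dots> \<le> \<delta>" using mC by (rule less_imp_le)
    finally show ?thesis .
  qed
  from conditional_fun_entropy_le[OF Q simple_function_word[OF f] p0(1,2) this]
  have "fun_entropy M (\<lambda>x. (Q x, ?R x)) - fun_entropy M ?R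
      \<le> real (card (Q ` space M)) * (p0 + \<delta> * L)" by (simp add: L_def)
  also have "\<dots> \<le> K * (p0 + \<delta> * L)"
    using p0 \<delta> L by (intro mult_right_mono) (auto simp: K_def)
  also have "\<dots> \<le> K * (e / (2 * K) + e / (2 * K))"
    using p0 K L by (intro mult_left_mono add_mono) (auto simp: \<delta>_def)
  also have "\<dots> = e" using K by simp
  finally show "fun_rate Q \<le> fun_rate f + e"
    using fun_rate_le_conditional[OF Q f, of m] by simp
qed

corollary ks_entropy_generator:
  fixes f :: "'a \<Rightarrow> 'b::countable"
  assumes f: "simple_function M f" and dec: "dec \<in> seqs \<rightarrow>\<^sub>M M"
    and inv: "AE x in M. dec (itinerary T f x) = x"
  shows "ks_entropy M T = ereal (fun_rate f)"
proof (rule antisym)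
  show "ks_entropy M T \<le> ereal (fun_rate f)"
    unfolding ks_entropy_def
  proof (rule SUP_least)
    fix P assume "P \<in> finite_partitions M"
    then obtain q :: "'a \<Rightarrow> 'a set" where q: "simple_function M q" "fibres M q = P"
      by (rule finite_partition_eq_fibres)
    show "ereal (entropy_wrt_partition M T P) \<le> ereal (fun_rate f)"
      using fun_rate_le_generator[OF f dec inv q(1)] entropy_wrt_fibres[OF q(1)] q(2) by simp
  qed
qed (rule fun_rate_le_ks_entropy[OF f])

end

section \<open>The induced map and its inverse branches\<close>

text \<open>\<open>root\<close> is the defining equation multiplied by \<open>\<beta> - 1\<close>,
  with \<open>m = n - 1\<close> the number of branches per digit. It forces
  \<open>1 + \<beta> - \<beta>\<^sup>2 > 0\<close>, so \<beta> lies below the golden ratio.\<close>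

locale shrinking_beta =
  fixes \<beta> :: real and m :: nat
  assumes beta: "1 < \<beta>" and m: "2 \<le> m" and root: "\<beta> ^ m * (1 + \<beta> - \<beta>\<^sup>2) = 1"
begin

abbreviation "a \<equiv> switch_left \<beta>"
abbreviation "b \<equiv> switch_right \<beta>"
abbreviation "c \<equiv> 1 / (\<beta> - 1)"
abbreviation "J \<equiv> UNIV \<times> {a..b} :: ((nat \<Rightarrow> bool) \<times> real) set"
abbreviation "I \<equiv> induced_K \<beta>"
abbreviation "ret \<equiv> return_time (K \<beta>) J"

lemma sq: "1 < \<beta>\<^sup>2"
  using beta by (simp add: one_less_power)

lemma a_pos: "0 < a"
  using sq by (simp add: switch_left_def)

lemma b_eq: "b = \<beta> * a"
  by (simp add: switch_left_def switch_right_def)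

lemma beta_b: "\<beta> * b = 1 + a"
  using sq by (simp add: switch_left_def switch_right_def field_simps power2_eq_square)

lemma a_less_b: "a < b"
  using beta a_pos by (simp add: b_eq)

lemma c_eq: "c = a + b"
proof -
  have "a + b = (\<beta> + 1) / ((\<beta> - 1) * (\<beta> + 1))"
    by (simp add: switch_left_def switch_right_def add_divide_distrib algebra_simps power2_eq_square)
  thus ?thesis using beta by simp
qed

lemma beta_c: "\<beta> * c = c + 1"
  using beta by (simp add: field_simps)

lemma b_minus_1: "\<beta> ^ m * (b - 1) = a"
proof -
  have "b - 1 = (1 + \<beta> - \<beta>\<^sup>2) / (\<beta>\<^sup>2 - 1)"
    using sq by (simp add: switch_right_def field_simps)
  hence "\<beta> ^ m * (b - 1) = \<beta> ^ m * (1 + \<beta> - \<beta>\<^sup>2) / (\<beta>\<^sup>2 - 1)" by simp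
  thus ?thesis by (simp add: root switch_left_def)
qed

lemma K_low: "x < a \<Longrightarrow> K \<beta> (\<omega>, x) = (\<omega>, \<beta> * x)"
  by (simp add: K_def)

lemma K_switch: "a \<le> x \<Longrightarrow> x \<le> b \<Longrightarrow> K \<beta> (\<omega>, x) = (shift \<omega>, \<beta> * x - of_bool (\<omega> 0))"
  by (simp add: K_def)

text \<open>The symmetry between the two digits. It commutes with \<open>K\<close> because
  \<open>c = a + b\<close> makes it swap the two regions outside the switch region and
  \<open>\<beta> * c = c + 1\<close> matches the branches; facts about digit 1 thereby yield those
  about digit 0.\<close>

definition flip :: "(nat \<Rightarrow> bool) \<times> real \<Rightarrow> (nat \<Rightarrow> bool) \<times> real" where
  "flip = (\<lambda>(\<omega>, x). (\<lambda>i. \<not> \<omega> i, c - x))"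

lemma flip_J: "flip p \<in> J \<longleftrightarrow> p \<in> J"
  unfolding flip_def c_eq by (cases p) auto

lemma K_flip: "K \<beta> (flip p) = flip (K \<beta> p)"
proof (cases p)
  case (Pair \<omega> x)
  have "\<beta> * (c - x) = c + 1 - \<beta> * x" using beta_c by (simp add: right_diff_distrib)
  thus ?thesis
    unfolding Pair flip_def K_def using a_less_b c_eq
    by (cases "\<omega> 0") (auto simp: shift_def)
qed

lemma K_pow_flip: "(K \<beta> ^^ i) (flip p) = flip ((K \<beta> ^^ i) p)"
  by (induction i) (simp_all add: K_flip)

lemma ret_flip: "ret (flip p) = ret p"
  unfolding return_time_def K_pow_flip flip_J ..

lemma I_flip: "I (flip p) = flip (I p)"
  unfolding induced_K_def induced_map_def ret_flip K_pow_flip ..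

section \<open>Return times and the images of the end points\<close>

lemma ret_eqI:
  assumes "1 \<le> k" "(K \<beta> ^^ k) p = q" "q \<in> J" "\<And>j. 1 \<le> j \<Longrightarrow> j < k \<Longrightarrow> (K \<beta> ^^ j) p \<notin> J"
  shows "ret p = k" "I p = q"
proof -
  show *: "ret p = k"
    unfolding return_time_def
  proof (rule Least_equality)
    fix j assume "1 \<le> j \<and> (K \<beta> ^^ j) p \<in> J"
    with assms(4)[of j] show "k \<le> j" by (meson not_le)
  qed (use assms in simp)
  show "I p = q" unfolding induced_K_def induced_map_def * by (rule assms(2))
qed

text \<open>Strictness of \<open>y < b\<close> is what rules out an earlier return: before time
  \<open>Suc k\<close> the orbit stays below \<open>b / \<beta> = a\<close>. With
  \<open>y = b\<close> it would already have returned, at \<open>a\<close>, one step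
  earlier.\<close>

lemma branch_True:
  assumes x: "a \<le> x" "x \<le> b" and "\<omega> 0" and k: "1 \<le> k"
    and y: "y = \<beta> ^ k * (\<beta> * x - 1)" "a \<le> y" "y < b"
  shows "ret (\<omega>, x) = Suc k" "I (\<omega>, x) = (shift \<omega>, y)"
proof -
  define z where "z = \<beta> * x - 1"
  have z: "0 < z"
  proof -
    have "0 < \<beta> ^ k * z" using a_pos y by (simp add: z_def)
    thus ?thesis using beta by (simp add: zero_less_mult_iff)
  qed
  have low: "\<beta> ^ j * z < a" if "j < k" for j
  proof -
    have "\<beta> ^ Suc j * z \<le> \<beta> ^ k * z"
      using that beta z by (intro mult_right_mono power_increasing) auto
    also have "\<dots> < \<beta> * a" using y by (simp add: z_def b_eq)
    finally have "\<beta> * (\<beta> ^ j * z) < \<beta> * a" by (simp add: mult.assoc)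
    thus ?thesis using beta by simp
  qed
  have pow: "(K \<beta> ^^ Suc j) (\<omega>, x) = (shift \<omega>, \<beta> ^ j * z)" if "j \<le> k" for j
    using that
  proof (induction j)
    case 0
    show ?case using K_switch[OF x, of \<omega>] \<open>\<omega> 0\<close> by (simp add: z_def)
  next
    case (Suc j)
    have "(K \<beta> ^^ Suc (Suc j)) (\<omega>, x) = K \<beta> ((K \<beta> ^^ Suc j) (\<omega>, x))" by simp
    also have "\<dots> = (shift \<omega>, \<beta> * (\<beta> ^ j * z))"
      using Suc K_low[OF low[of j], of "shift \<omega>"] by simp
    finally show ?case by (simp add: mult.assoc)
  qed
  have J: "(shift \<omega>, y) \<in> J" using y by simp
  have ret_k: "(K \<beta> ^^ Suc k) (\<omega>, x) = (shift \<omega>, y)" using pow[of k] y(1) by (simp add: z_def)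
  have before: "(K \<beta> ^^ j) (\<omega>, x) \<notin> J" if "1 \<le> j" "j < Suc k" for j
    using pow[of "j - 1"] low[of "j - 1"] that by (cases j) auto
  show "ret (\<omega>, x) = Suc k" "I (\<omega>, x) = (shift \<omega>, y)"
    using ret_eqI[OF _ ret_k J before] by auto
qed

lemma I_b_True:
  assumes "\<omega> 0" shows "I (\<omega>, b) = (shift \<omega>, a)"
  using a_less_b assms K_switch[of b \<omega>] beta_b by (intro ret_eqI(2)[of 1]) auto

text \<open>Here \<open>\<beta> * a - 1 = b - 1\<close>, and exactly \<open>m\<close>
  multiplications by \<beta> lift \<open>b - 1\<close> back to \<open>a\<close>.\<close>

lemma I_a_True:
  assumes "\<omega> 0" shows "I (\<omega>, a) = (shift \<omega>, a)"
  using m a_less_b assms b_minus_1 b_eq by (intro branch_True(2)[of _ _ m]) auto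

text \<open>Both end points have the same image. Hence along an orbit in the end-point set every end
  point after the first is dictated by the digit read just before, which keeps the number of words
  there small.\<close>

lemma I_boundary:
  assumes "x \<in> {a, b}"
  shows "I (\<omega>, x) = (shift \<omega>, if \<omega> 0 then a else b)"
proof (cases "\<omega> 0")
  case True
  thus ?thesis using assms I_b_True I_a_True by auto
next
  case False
  define \<omega>' where "\<omega>' = (\<lambda>i. \<not> \<omega> i)"
  have "I (\<omega>', c - x) = (shift \<omega>', a)"
    using False assms I_a_True[of \<omega>'] I_b_True[of \<omega>'] by (auto simp: \<omega>'_def c_eq)
  moreover have "(\<omega>, x) = flip (\<omega>', c - x)" by (simp add: flip_def \<omega>'_def)
  ultimately have "I (\<omega>, x) = flip (shift \<omega>', a)" by (simp add: I_flip)
  also have "\<dots> = (shift \<omega>, b)" by (simp add: flip_def \<omega>'_def shift_def c_eq)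
  finally show ?thesis using False by simp
qed

text \<open>Inverse branches: for digit 1 this solves
  \<open>y = \<beta> ^ k * (\<beta> * x - 1)\<close> for \<open>x\<close>; for digit 0 it is the
  conjugate of that map under the reflection at \<open>c\<close>.\<close>

definition F :: "bool \<times> nat \<Rightarrow> real \<Rightarrow> real" where
  "F = (\<lambda>(d, k) y. if d then (1 + y / \<beta> ^ k) / \<beta> else c - (1 + (c - y) / \<beta> ^ k) / \<beta>)"

lemma F_flip: "F (\<not> d, k) (c - y) = c - F (d, k) y"
  by (simp add: F_def)

lemma F_diff: "F (d, k) y - F (d, k) y' = (y - y') / \<beta> ^ Suc k"
proof -
  have *: "F (True, k) u - F (True, k) v = (u - v) / \<beta> ^ Suc k" for u v
    by (simp add: F_def add_divide_distrib diff_divide_distrib mult.commute)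
  show ?thesis
    using *[of y y'] *[of "c - y'" "c - y"] F_flip[of False k y] F_flip[of False k y'] by (cases d) auto
qed

lemma F_contracting: "\<bar>F (d, k) y - F (d, k) y'\<bar> \<le> \<bar>y - y'\<bar> / \<beta>"
proof -
  have "\<bar>y - y'\<bar> / \<beta> ^ Suc k \<le> \<bar>y - y'\<bar> / \<beta> ^ 1"
    using beta by (intro divide_left_mono power_increasing) auto
  thus ?thesis using beta by (simp add: F_diff abs_divide)
qed

text \<open>Everything reduces to \<open>(b - 1) * \<beta> ^ k \<le> a\<close> and
  \<open>b \<le> a * \<beta> ^ k\<close>, which are equalities only at \<open>k = m\<close> and at
  \<open>k = 1\<close> respectively. The equality cases later identify the sequences that decode to
  an end point.\<close>

lemma F_True_bounds:
  assumes "1 \<le> k" "k \<le> m" "a \<le> y" "y \<le> b"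
  shows "a \<le> F (True, k) y" "F (True, k) y \<le> b"
    "a < y \<Longrightarrow> a < F (True, k) y" "y < b \<Longrightarrow> F (True, k) y < b"
    "F (True, k) y = a \<Longrightarrow> k = m" "F (True, k) y = b \<Longrightarrow> k = 1"
proof -
  have pw: "\<beta> \<le> \<beta> ^ k" "\<beta> ^ k \<le> \<beta> ^ m" "0 < \<beta> ^ k"
    using assms beta power_increasing[of 1 k \<beta>] by (auto intro: power_increasing)
  have "(b - 1) * \<beta> ^ k \<le> (b - 1) * \<beta> ^ m"
  proof (intro mult_left_mono pw)
    have "0 < \<beta> ^ m * (b - 1)" using b_minus_1 a_pos by simp
    thus "0 \<le> b - 1" using beta by (simp add: zero_less_mult_iff)
  qed
  hence lo: "(b - 1) * \<beta> ^ k \<le> a" using b_minus_1 by (simp add: mult.commute)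
  have hi: "b \<le> a * \<beta> ^ k" using pw(1) a_pos by (simp add: b_eq mult.commute)
  have eq: "F (True, k) y - a = (y - (b - 1) * \<beta> ^ k) / \<beta> ^ Suc k"
    "b - F (True, k) y = (a * \<beta> ^ k - y) / \<beta> ^ Suc k"
  proof -
    have "F (True, k) y - a = (1 + y / \<beta> ^ k - b) / \<beta>"
      using beta by (simp add: F_def b_eq diff_divide_distrib)
    thus "F (True, k) y - a = (y - (b - 1) * \<beta> ^ k) / \<beta> ^ Suc k"
      using beta by (simp add: field_simps)
    have "b - F (True, k) y = (\<beta> * b - 1 - y / \<beta> ^ k) / \<beta>"
      using beta by (simp add: F_def diff_divide_distrib add_divide_distrib)
    thus "b - F (True, k) y = (a * \<beta> ^ k - y) / \<beta> ^ Suc k"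
      using beta by (simp add: beta_b field_simps)
  qed
  have pos: "0 < \<beta> ^ Suc k" using beta by simp
  have "0 \<le> F (True, k) y - a" unfolding eq using lo assms pos by (intro divide_nonneg_pos) auto
  thus "a \<le> F (True, k) y" by simp
  have "0 \<le> b - F (True, k) y" unfolding eq using hi assms pos by (intro divide_nonneg_pos) auto
  thus "F (True, k) y \<le> b" by simp
  show "a < F (True, k) y" if "a < y"
  proof -
    have "0 < F (True, k) y - a" unfolding eq using lo that pos by (intro divide_pos_pos) auto
    thus ?thesis by simp
  qed
  show "F (True, k) y < b" if "y < b"
  proof -
    have "0 < b - F (True, k) y" unfolding eq using hi that pos by (intro divide_pos_pos) auto
    thus ?thesis by simp
  qed
  show "k = m" if "F (True, k) y = a"
  proof -
    have "y = (b - 1) * \<beta> ^ k" using that eq(1) pos beta by simp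
    with assms(3) lo have "(b - 1) * \<beta> ^ k = (b - 1) * \<beta> ^ m"
      using b_minus_1 by (simp add: mult.commute)
    moreover have "b - 1 \<noteq> 0" using b_minus_1 a_pos by auto
    ultimately show ?thesis using beta by (simp add: power_inject_exp)
  qed
  show "k = 1" if "F (True, k) y = b"
  proof -
    have "y = a * \<beta> ^ k" using that eq(2) pos beta by simp
    hence "a * \<beta> ^ k = b" using assms(4) hi by linarith
    hence "\<beta> ^ k = \<beta> ^ 1" using a_pos by (simp add: b_eq)
    thus ?thesis using beta power_inject_exp by blast
  qed
qed

lemma F_bounds:
  assumes "1 \<le> k" "k \<le> m" "a \<le> y" "y \<le> b"
  shows "a \<le> F (d, k) y" "F (d, k) y \<le> b"
    "a < y \<Longrightarrow> a < F (d, k) y" "y < b \<Longrightarrow> F (d, k) y < b"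
    "F (d, k) y = a \<Longrightarrow> k = (if d then m else 1)" "F (d, k) y = b \<Longrightarrow> k = (if d then 1 else m)"
proof -
  have y': "a \<le> c - y" "c - y \<le> b" using assms(3,4) c_eq by auto
  have *: "F (False, k) y = a + b - F (True, k) (c - y)" "c - y = a + b - y"
    using F_flip[of False k y] c_eq by auto
  note T = F_True_bounds[OF assms] and F = F_True_bounds[OF assms(1,2) y', unfolded *(2)]
  show "a \<le> F (d, k) y" using T(1) F(2) * by (cases d) auto
  show "F (d, k) y \<le> b" using T(2) F(1) * by (cases d) auto
  show "a < y \<Longrightarrow> a < F (d, k) y" using T(3) F(4) * by (cases d) auto
  show "y < b \<Longrightarrow> F (d, k) y < b" using T(4) F(3) * by (cases d) auto
  show "F (d, k) y = a \<Longrightarrow> k = (if d then m else 1)" using T(5) F(6) * by (cases d) auto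
  show "F (d, k) y = b \<Longrightarrow> k = (if d then 1 else m)" using T(6) F(5) * by (cases d) auto
qed

lemma F_True_inverse:
  assumes "x = F (True, k) y"
  shows "y = \<beta> ^ k * (\<beta> * x - 1)"
  using assms beta by (simp add: F_def field_simps)

text \<open>The excluded target is the open end of the branch: for digit 1 an orbit aiming at
  \<open>b\<close> returns one step earlier at \<open>a\<close>, and for digit 0 the mirror image
  happens.\<close>

lemma I_F:
  assumes k: "1 \<le> k" "k \<le> m" and y: "a \<le> y" "y \<le> b"
    and "y \<noteq> (if \<omega> 0 then b else a)"
  shows "ret (\<omega>, F (\<omega> 0, k) y) = Suc k" "I (\<omega>, F (\<omega> 0, k) y) = (shift \<omega>, y)"
proof -
  have "ret (\<omega>, F (\<omega> 0, k) y) = Suc k \<and> I (\<omega>, F (\<omega> 0, k) y) = (shift \<omega>, y)"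
  proof (cases "\<omega> 0")
    case True
    thus ?thesis using branch_True[OF F_True_bounds(1,2)[OF k y] _ k(1) F_True_inverse[OF refl]] y assms(5)
      by auto
  next
    case False
    define \<omega>' where "\<omega>' = (\<lambda>i. \<not> \<omega> i)"
    define x' where "x' = F (True, k) (c - y)"
    have y': "a \<le> c - y" "c - y \<le> b" "c - y < b" using y assms(5) False c_eq by auto
    have "ret (\<omega>', x') = Suc k" "I (\<omega>', x') = (shift \<omega>', c - y)"
      using branch_True[OF F_True_bounds(1,2)[OF k y'(1,2)] _ k(1) F_True_inverse[OF refl] y'(1,3), of \<omega>']
        False by (auto simp: \<omega>'_def x'_def)
    moreover have "(\<omega>, F (\<omega> 0, k) y) = flip (\<omega>', x')"
      using False F_flip[of False k y] by (simp add: flip_def \<omega>'_def x'_def)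
    moreover have "flip (shift \<omega>', c - y) = (shift \<omega>, y)"
      by (simp add: flip_def \<omega>'_def shift_def)
    ultimately show ?thesis by (simp add: ret_flip I_flip)
  qed
  thus "ret (\<omega>, F (\<omega> 0, k) y) = Suc k" "I (\<omega>, F (\<omega> 0, k) y) = (shift \<omega>, y)" by auto
qed

text \<open>The first image \<open>z\<close> lies in \<open>[b - 1, a)\<close>. At the least
  exponent \<open>k\<close> that lifts it to at least \<open>a\<close>, the previous value is below
  \<open>a\<close>, so the new one is below \<open>\<beta> * a = b\<close>; \<open>m\<close> steps
  suffice even from \<open>b - 1\<close>.\<close>

lemma F_True_surj:
  assumes x: "a \<le> x" "x < b"
  obtains k y where "1 \<le> k" "k \<le> m" "a \<le> y" "y < b" "x = F (True, k) y"
proof -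
  define z where "z = \<beta> * x - 1"
  define k where "k = (LEAST k. a \<le> \<beta> ^ k * z)"
  have "b - 1 \<le> z" using x beta by (simp add: z_def b_eq)
  hence "\<beta> ^ m * (b - 1) \<le> \<beta> ^ m * z" using beta by (intro mult_left_mono) auto
  hence "a \<le> \<beta> ^ m * z" using b_minus_1 by simp
  hence k: "a \<le> \<beta> ^ k * z" "k \<le> m" unfolding k_def by (rule LeastI, rule Least_le)
  have za: "z < a"
  proof -
    have "\<beta> * x < \<beta> * b" using x beta by simp
    thus ?thesis using beta_b by (simp add: z_def)
  qed
  have "k \<noteq> 0" using k(1) za by (auto intro: Nat.gr0I)
  then obtain j where j: "k = Suc j" using not0_implies_Suc by blast
  have "\<not> a \<le> \<beta> ^ j * z" using not_less_Least[of j "\<lambda>k. a \<le> \<beta> ^ k * z"] j by (simp add: k_def)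
  hence "\<beta> * (\<beta> ^ j * z) < \<beta> * a" using beta by simp
  hence "\<beta> ^ k * z < b" by (simp add: j b_eq mult.assoc)
  moreover have "x = F (True, k) (\<beta> ^ k * z)" using beta by (simp add: F_def z_def)
  ultimately show thesis using that[of k "\<beta> ^ k * z"] k \<open>k \<noteq> 0\<close> by simp
qed

lemma interior_branch:
  assumes x: "a < x" "x < b"
  obtains k y where "1 \<le> k" "k \<le> m" "a \<le> y" "y \<le> b" "x = F (\<omega> 0, k) y"
    "ret (\<omega>, x) = Suc k" "I (\<omega>, x) = (shift \<omega>, y)"
proof (cases "\<omega> 0")
  case True
  obtain k y where "1 \<le> k" "k \<le> m" "a \<le> y" "y < b" "x = F (True, k) y"
    using F_True_surj[of x] x by auto
  thus thesis using that[of k y] I_F[of k y \<omega>] True by auto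
next
  case False
  obtain k y where ky: "1 \<le> k" "k \<le> m" "a \<le> y" "y < b" "c - x = F (True, k) y"
    using F_True_surj[of "c - x"] x c_eq by auto
  have "x = F (False, k) (c - y)" using F_flip[of True k y] ky(5) by simp
  thus thesis using that[of k "c - y"] I_F[of k "c - y" \<omega>] False ky c_eq by auto
qed

lemma I_in_J:
  assumes "a \<le> x" "x \<le> b" shows "I (\<omega>, x) \<in> J"
proof (cases "x \<in> {a, b}")
  case True
  thus ?thesis unfolding I_boundary[OF True] using a_less_b by simp
next
  case False
  hence "a < x" "x < b" using assms by auto
  then obtain k y where "a \<le> y" "y \<le> b" "I (\<omega>, x) = (shift \<omega>, y)"
    using interior_branch by metis
  thus ?thesis by simp
qed

end

section \<open>Measurability and coding\<close>

text \<open>The tangent inequality \<open>ln x \<le> x - 1\<close> at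
  \<open>x = 1 / (p v * N)\<close>. In the applications \<open>p\<close> has total mass below or
  equal to 1; the slack \<open>1 - sum p A\<close> does not grow with \<open>N\<close>, so it
  disappears on division by the word length.\<close>

lemma neg_sum_ln_le:
  fixes p :: "'a \<Rightarrow> real" and N :: real
  assumes "finite A" and p: "\<And>v. v \<in> A \<Longrightarrow> 0 \<le> p v" and N: "real (card A) \<le> N" "0 < N"
  shows "- (\<Sum>v\<in>A. p v * ln (p v)) \<le> sum p A * ln N + 1 - sum p A"
proof -
  have summand_le: "- (p v * ln (p v)) \<le> p v * ln N + 1 / N - p v" if "v \<in> A" for v
  proof (cases "p v = 0")
    case False
    hence pv: "0 < p v" using p[OF that] by simp
    have "p v * ln (1 / (p v * N)) \<le> p v * (1 / (p v * N) - 1)"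
      using pv N by (intro mult_left_mono ln_le_minus_one) auto
    thus ?thesis using pv N by (simp add: ln_div ln_mult right_diff_distrib distrib_left)
  qed (use N in simp)
  have "- (\<Sum>v\<in>A. p v * ln (p v)) \<le> (\<Sum>v\<in>A. p v * ln N + 1 / N - p v)"
    unfolding sum_negf[symmetric] by (intro sum_mono summand_le)
  also have "\<dots> = sum p A * ln N + real (card A) / N - sum p A"
    by (simp add: sum.distrib sum_subtractf sum_distrib_right)
  also have "real (card A) / N \<le> 1" using N by simp
  finally show ?thesis by simp
qed

text \<open>The equality case: each gap \<open>?g v\<close> is nonnegative and their sum is not
  positive, so all vanish. A vanishing \<open>p v\<close> would leave the gap \<open>1 / N\<close>,
  and otherwise \<open>ln t = t - 1\<close> only at \<open>t = 1\<close>.\<close>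

lemma neg_sum_ln_maximal:
  fixes p :: "'a \<Rightarrow> real"
  assumes "finite A" "A \<noteq> {}" and p: "\<And>v. v \<in> A \<Longrightarrow> 0 \<le> p v" and sum: "sum p A = 1"
    and ge: "ln (real (card A)) \<le> - (\<Sum>v\<in>A. p v * ln (p v))" and v: "v \<in> A"
  shows "p v = 1 / real (card A)"
proof -
  define N where "N = real (card A)"
  have N: "0 < N" using assms(1,2) by (simp add: N_def card_gt_0_iff)
  let ?g = "\<lambda>v. p v * ln N + 1 / N - p v + p v * ln (p v)"
  have nn: "0 \<le> ?g v \<and> (?g v = 0 \<longrightarrow> p v = 1 / N)" if "v \<in> A" for v
  proof (cases "p v = 0")
    case False
    hence pv: "0 < p v" using p[OF that] by simp
    define t where "t = 1 / (p v * N)"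
    have t: "0 < t" using pv N by (simp add: t_def)
    have eq: "?g v = p v * (t - 1 - ln t)"
      using pv N by (simp add: t_def ln_div ln_mult right_diff_distrib distrib_left)
    have "0 \<le> ?g v" unfolding eq using pv ln_le_minus_one[OF t] by simp
    moreover have "p v = 1 / N" if "?g v = 0"
    proof -
      have "ln t = t - 1" using that pv unfolding eq by simp
      hence "t = 1" using t ln_eq_minus_one by blast
      thus ?thesis using pv N by (simp add: t_def field_simps)
    qed
    ultimately show ?thesis by blast
  qed (use N in simp)
  have "(\<Sum>v\<in>A. ?g v) = sum p A * ln N + real (card A) / N - sum p A + (\<Sum>v\<in>A. p v * ln (p v))"
    by (simp add: sum.distrib sum_subtractf sum_distrib_right)
  also have "\<dots> \<le> 0" using ge N by (simp add: sum N_def)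
  finally have "(\<Sum>v\<in>A. ?g v) \<le> 0" .
  moreover have "0 \<le> (\<Sum>v\<in>A. ?g v)" using nn by (intro sum_nonneg) blast
  ultimately have "(\<Sum>v\<in>A. ?g v) = 0" by (rule antisym)
  hence "?g v = 0" using sum_nonneg_eq_0_iff[of A ?g] nn assms(1) v by blast
  thus ?thesis using nn[OF v] by (simp add: N_def)
qed

section \<open>Measurability of the induced map and of the labels\<close>

lemma Omega_eq_seqs: "Omega = seqs"
  by (simp add: Omega_def seqs_def)

lemma measurable_tail: "(\<lambda>s i. s (Suc i)) \<in> seqs \<rightarrow>\<^sub>M seqs"
  by (intro measurable_into_seqs measurable_seqs_component)

lemma measurable_shift: "shift \<in> Omega \<rightarrow>\<^sub>M Omega"
  unfolding Omega_eq_seqs shift_def by (rule measurable_tail)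

lemma measurable_Omega_component: "(\<lambda>s. s i) \<in> Omega \<rightarrow>\<^sub>M count_space UNIV"
  unfolding Omega_eq_seqs by (rule measurable_seqs_component)

context shrinking_beta
begin

abbreviation "X \<equiv> switch_space \<beta>"

lemma space_X: "space X = J"
  by (simp add: switch_space_def space_pair_measure Omega_eq_seqs space_restrict_space)

lemma measurable_K [measurable]: "K \<beta> \<in> Omega \<Otimes>\<^sub>M borel \<rightarrow>\<^sub>M Omega \<Otimes>\<^sub>M borel"
proof -
  have shift': "(\<lambda>p :: (nat \<Rightarrow> bool) \<times> real. shift (fst p)) \<in> Omega \<Otimes>\<^sub>M borel \<rightarrow>\<^sub>M Omega"
    by (rule measurable_compose[OF measurable_fst measurable_shift])
  have digit: "Measurable.pred (Omega \<Otimes>\<^sub>M borel) (\<lambda>p :: (nat \<Rightarrow> bool) \<times> real. fst p 0)"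
    by (rule measurable_compose[OF measurable_fst measurable_Omega_component])
  have K_eq: "K \<beta> = (\<lambda>p. if snd p < a then (fst p, \<beta> * snd p)
      else if snd p \<le> b then (shift (fst p), \<beta> * snd p - of_bool (fst p 0))
      else (fst p, \<beta> * snd p - 1))"
    by (rule ext) (simp add: K_def case_prod_unfold)
  have 1: "(\<lambda>p :: (nat \<Rightarrow> bool) \<times> real. (fst p, \<beta> * snd p)) \<in> Omega \<Otimes>\<^sub>M borel \<rightarrow>\<^sub>M Omega \<Otimes>\<^sub>M borel"
    by measurable
  have 2: "(\<lambda>p :: (nat \<Rightarrow> bool) \<times> real. (fst p, \<beta> * snd p - 1)) \<in> Omega \<Otimes>\<^sub>M borel \<rightarrow>\<^sub>M Omega \<Otimes>\<^sub>M borel"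
    by measurable
  have "(\<lambda>p :: (nat \<Rightarrow> bool) \<times> real. \<beta> * snd p - (if fst p 0 then 1 else 0))
      \<in> Omega \<Otimes>\<^sub>M borel \<rightarrow>\<^sub>M borel"
    by (rule borel_measurable_diff[OF _ measurable_If[OF _ _ digit[unfolded pred_def]]]) measurable
  from measurable_Pair[OF shift' this]
  have 3: "(\<lambda>p :: (nat \<Rightarrow> bool) \<times> real. (shift (fst p), \<beta> * snd p - of_bool (fst p 0)))
      \<in> Omega \<Otimes>\<^sub>M borel \<rightarrow>\<^sub>M Omega \<Otimes>\<^sub>M borel"
    unfolding of_bool_def .
  show ?thesis
    unfolding K_eq by (rule measurable_If[OF 1 measurable_If[OF 3 2]]; measurable)
qed

lemma measurable_K_pow [measurable]: "K \<beta> ^^ k \<in> Omega \<Otimes>\<^sub>M borel \<rightarrow>\<^sub>M Omega \<Otimes>\<^sub>M borel"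
  by (induction k) (simp_all add: measurable_comp)

lemma sets_J [measurable]: "J \<in> sets (Omega \<Otimes>\<^sub>M borel)"
proof -
  have "UNIV \<in> sets (Omega :: (nat \<Rightarrow> bool) measure)"
    using sets.top[of Omega] by (simp add: Omega_eq_seqs)
  thus ?thesis by measurable
qed

lemma measurable_ret: "ret \<in> Omega \<Otimes>\<^sub>M borel \<rightarrow>\<^sub>M count_space UNIV"
  unfolding return_time_def
  by (intro measurable_Least pred_intros_logic pred_sets2[OF sets_J measurable_K_pow]) simp

lemma measurable_X_borel: "(\<lambda>p. p) \<in> X \<rightarrow>\<^sub>M Omega \<Otimes>\<^sub>M borel"
proof -
  have "(\<lambda>p. snd p) \<in> X \<rightarrow>\<^sub>M borel"
    unfolding switch_space_def
    by (rule measurable_compose[OF measurable_snd measurable_restrict_space1[OF measurable_ident_sets[OF refl]]])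
  moreover have "(\<lambda>p. fst p) \<in> X \<rightarrow>\<^sub>M Omega"
    unfolding switch_space_def by measurable
  ultimately have "(\<lambda>p. (fst p, snd p)) \<in> X \<rightarrow>\<^sub>M Omega \<Otimes>\<^sub>M borel" by measurable
  thus ?thesis by simp
qed

lemma measurable_into_X:
  assumes "g \<in> M \<rightarrow>\<^sub>M Omega" "h \<in> borel_measurable M" "\<And>x. x \<in> space M \<Longrightarrow> a \<le> h x \<and> h x \<le> b"
  shows "(\<lambda>x. (g x, h x)) \<in> M \<rightarrow>\<^sub>M X"
  unfolding switch_space_def
  using assms by (intro measurable_Pair measurable_restrict_space2) auto

lemma measurable_I: "I \<in> X \<rightarrow>\<^sub>M X"
proof -
  have "(\<lambda>p. (K \<beta> ^^ ret p) p) \<in> Omega \<Otimes>\<^sub>M borel \<rightarrow>\<^sub>M Omega \<Otimes>\<^sub>M borel"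
    by (rule measurable_compose_countable[OF _ measurable_ret]) measurable
  hence I: "I \<in> Omega \<Otimes>\<^sub>M borel \<rightarrow>\<^sub>M Omega \<Otimes>\<^sub>M borel"
    unfolding induced_K_def induced_map_def .
  have I': "(\<lambda>p. I p) \<in> X \<rightarrow>\<^sub>M Omega \<Otimes>\<^sub>M borel"
    using measurable_compose[OF measurable_X_borel I] .
  have "(\<lambda>p. (fst (I p), snd (I p))) \<in> X \<rightarrow>\<^sub>M X"
  proof (rule measurable_into_X)
    show "(\<lambda>p. fst (I p)) \<in> X \<rightarrow>\<^sub>M Omega" using I' by measurable
    show "(\<lambda>p. snd (I p)) \<in> X \<rightarrow>\<^sub>M borel" using I' by measurable
    fix p assume "p \<in> space X"
    hence "I p \<in> J" using I_in_J by (auto simp: space_X)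
    thus "a \<le> snd (I p) \<and> snd (I p) \<le> b" by auto
  qed
  thus ?thesis by simp
qed

text \<open>
  The labels \<open>0\<close> and \<open>m + 1\<close> mark the end points \<open>a\<close> and \<open>b\<close>, where the branches overlap.
\<close>

definition label :: "(nat \<Rightarrow> bool) \<times> real \<Rightarrow> bool \<times> nat" where
  "label p = (fst p 0, if snd p = a then 0 else if snd p = b then Suc m else ret p - 1)"

lemma measurable_label: "label \<in> X \<rightarrow>\<^sub>M count_space UNIV"
proof -
  have digit: "(\<lambda>p :: (nat \<Rightarrow> bool) \<times> real. fst p 0) \<in> Omega \<Otimes>\<^sub>M borel \<rightarrow>\<^sub>M count_space UNIV"
    by (rule measurable_compose[OF measurable_fst measurable_Omega_component])
  have "(\<lambda>p. ret p - 1) \<in> Omega \<Otimes>\<^sub>M borel \<rightarrow>\<^sub>M count_space UNIV"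
    by (rule measurable_compose[OF measurable_ret]) simp
  hence "(\<lambda>p. if snd p = a then 0 else if snd p = b then Suc m else ret p - 1)
      \<in> Omega \<Otimes>\<^sub>M borel \<rightarrow>\<^sub>M count_space UNIV"
    by (intro measurable_If measurable_const) simp_all
  with digit have "label \<in> Omega \<Otimes>\<^sub>M borel \<rightarrow>\<^sub>M count_space UNIV \<Otimes>\<^sub>M count_space UNIV"
    unfolding label_def[abs_def] by (rule measurable_Pair)
  hence "label \<in> Omega \<Otimes>\<^sub>M borel \<rightarrow>\<^sub>M count_space UNIV"
    by (simp add: pair_measure_countable)
  from measurable_compose[OF measurable_X_borel this] show ?thesis by simp
qed

lemma label_range: "p \<in> J \<Longrightarrow> label p \<in> UNIV \<times> {..Suc m}"
proof (cases p)
  case (Pair \<omega> x)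
  assume p: "p \<in> J"
  show ?thesis
  proof (cases "x \<in> {a, b}")
    case False
    hence "a < x" "x < b" using p by (auto simp: Pair)
    then obtain k y where "k \<le> m" "ret (\<omega>, x) = Suc k"
      using interior_branch by metis
    thus ?thesis by (simp add: Pair label_def)
  qed (auto simp: Pair label_def)
qed

definition Z :: "((nat \<Rightarrow> bool) \<times> real) set" where
  "Z = UNIV \<times> {a, b}"

lemma Z_subset: "Z \<subseteq> J"
  using a_less_b by (auto simp: Z_def)

lemma I_Z: "p \<in> Z \<Longrightarrow> I p \<in> Z"
  unfolding Z_def by (cases p) (auto simp: I_boundary)

lemma fst_I: "p \<in> J \<Longrightarrow> fst (I p) = shift (fst p)"
proof -
  assume p: "p \<in> J"
  obtain \<omega> x where Pair: "p = (\<omega>, x)" by (cases p)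
  show ?thesis
  proof (cases "x \<in> {a, b}")
    case True
    show ?thesis unfolding Pair I_boundary[OF True] by simp
  next
    case False
    hence "a < x" "x < b" using p by (auto simp: Pair)
    then obtain k y where "I (\<omega>, x) = (shift \<omega>, y)"
      using interior_branch by metis
    thus ?thesis by (simp add: Pair)
  qed
qed

lemma I_pow_J: "p \<in> J \<Longrightarrow> (I ^^ i) p \<in> J"
proof (induction i)
  case (Suc i)
  thus ?case using I_in_J[of "snd ((I ^^ i) p)" "fst ((I ^^ i) p)"] by (auto simp: mem_Times_iff)
qed simp

lemma fst_I_pow: "p \<in> J \<Longrightarrow> fst ((I ^^ i) p) = (\<lambda>j. fst p (j + i))"
  by (induction i) (auto simp: fst_I[OF I_pow_J] shift_def)

lemma fst_label_pow: "p \<in> J \<Longrightarrow> fst (label ((I ^^ i) p)) = fst p i"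
  by (simp add: label_def fst_I_pow)

text \<open>Labels outside \<open>1, ..., m\<close> are sent to branch 1, so that every sequence of
  labels acts by contractions of \<open>[a, b]\<close> and can be decoded.\<close>

definition G :: "bool \<times> nat \<Rightarrow> real \<Rightarrow> real" where
  "G = (\<lambda>(d, k). F (d, if 1 \<le> k \<and> k \<le> m then k else 1))"

lemma G_bounds:
  assumes "a \<le> y" "y \<le> b"
  shows "a \<le> G w y" "G w y \<le> b"
  using F_bounds(1,2)[of _ y] assms m by (auto simp: G_def split: prod.split)

lemma G_mono: "y \<le> y' \<Longrightarrow> G w y \<le> G w y'"
proof -
  assume "y \<le> y'"
  have "F (d, k) y \<le> F (d, k) y'" for d k
  proof -
    have "0 \<le> F (d, k) y' - F (d, k) y" unfolding F_diff using beta \<open>y \<le> y'\<close> by simp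
    thus ?thesis by simp
  qed
  thus ?thesis by (auto simp: G_def split: prod.split)
qed

lemma G_contracting: "\<bar>G w y - G w y'\<bar> \<le> \<bar>y - y'\<bar> / \<beta>"
  using F_contracting by (auto simp: G_def split: prod.split)

lemma G_continuous: "continuous_on UNIV (G w)"
  unfolding G_def F_def using beta
  by (cases w; cases "fst w") (auto intro!: continuous_intros)

text \<open>The composition of the first \<open>j\<close> branches applied to \<open>a\<close>.
  Starting from the left end makes it increasing in \<open>j\<close>, so convergence follows from
  monotonicity and the bound \<open>b\<close>.\<close>

primrec approx :: "nat \<Rightarrow> (nat \<Rightarrow> bool \<times> nat) \<Rightarrow> real" where
  "approx 0 s = a"
| "approx (Suc j) s = G (s 0) (approx j (\<lambda>i. s (Suc i)))"

definition point :: "(nat \<Rightarrow> bool \<times> nat) \<Rightarrow> real" where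
  "point s = lim (\<lambda>j. approx j s)"

lemma approx_bounds: "a \<le> approx j s" "approx j s \<le> b"
proof -
  have "a \<le> approx j s \<and> approx j s \<le> b"
    by (induction j arbitrary: s) (use a_less_b G_bounds in auto)
  thus "a \<le> approx j s" "approx j s \<le> b" by auto
qed

lemma approx_LIMSEQ: "(\<lambda>j. approx j s) \<longlonglongrightarrow> point s"
proof -
  have "approx j s \<le> approx (Suc j) s" for j s
  proof (induction j arbitrary: s)
    case 0
    show ?case using G_bounds(1)[of a] a_less_b by simp
  next
    case (Suc j)
    show ?case using G_mono[OF Suc[of "\<lambda>i. s (Suc i)"]] by simp
  qed
  hence "incseq (\<lambda>j. approx j s)" by (rule incseq_SucI)
  moreover have "\<forall>j. approx j s \<le> b" using approx_bounds(2) by simp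
  ultimately obtain L where "(\<lambda>j. approx j s) \<longlonglongrightarrow> L"
    by (rule incseq_convergent)
  thus ?thesis unfolding point_def by (simp add: limI)
qed

lemma point_bounds: "a \<le> point s" "point s \<le> b"
  by (rule LIMSEQ_le_const[OF approx_LIMSEQ], simp add: approx_bounds,
      rule LIMSEQ_le_const2[OF approx_LIMSEQ], simp add: approx_bounds)

lemma point_rec: "point s = G (s 0) (point (\<lambda>i. s (Suc i)))"
proof (rule LIMSEQ_unique)
  show "(\<lambda>j. approx (Suc j) s) \<longlonglongrightarrow> point s"
    using approx_LIMSEQ by (rule LIMSEQ_Suc)
  have "(\<lambda>j. G (s 0) (approx j (\<lambda>i. s (Suc i)))) \<longlonglongrightarrow> G (s 0) (point (\<lambda>i. s (Suc i)))"
    by (rule continuous_on_tendsto_compose[OF G_continuous approx_LIMSEQ]) simp_all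
  thus "(\<lambda>j. approx (Suc j) s) \<longlonglongrightarrow> G (s 0) (point (\<lambda>i. s (Suc i)))" by simp
qed

text \<open>Every use of the recursion shrinks the distance to \<open>approx\<close> by the factor
  \<beta>, starting from at most \<open>b - a\<close>. So an orbit is determined by the branches
  that it follows.\<close>

lemma point_unique:
  assumes u: "\<And>j. a \<le> u j" "\<And>j. u j \<le> b" and rec: "\<And>j. u j = G (s j) (u (Suc j))"
  shows "u 0 = point s"
proof -
  have bound: "\<bar>u 0 - approx j s\<bar> \<le> (b - a) * (1 / \<beta>) ^ j"
    if "\<And>j. a \<le> u j" "\<And>j. u j \<le> b" "\<And>j. u j = G (s j) (u (Suc j))" for j u s
    using that
  proof (induction j arbitrary: u s)
    case 0
    show ?case using 0(1)[of 0] 0(2)[of 0] by simp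
  next
    case (Suc j)
    have "\<bar>u 0 - approx (Suc j) s\<bar>
        = \<bar>G (s 0) (u (Suc 0)) - G (s 0) (approx j (\<lambda>i. s (Suc i)))\<bar>"
      by (simp only: Suc.prems(3)[of 0] approx.simps)
    also have "\<dots> \<le> \<bar>u (Suc 0) - approx j (\<lambda>i. s (Suc i))\<bar> / \<beta>" by (rule G_contracting)
    also have "\<dots> \<le> (b - a) * (1 / \<beta>) ^ j / \<beta>"
    proof (rule divide_right_mono)
      show "\<bar>u (Suc 0) - approx j (\<lambda>i. s (Suc i))\<bar> \<le> (b - a) * (1 / \<beta>) ^ j"
        by (rule Suc.IH[of "\<lambda>i. u (Suc i)"]) (rule Suc.prems)+
    qed (use beta in simp)
    finally show ?case by simp
  qed
  have "(\<lambda>j. (b - a) * (1 / \<beta>) ^ j) \<longlonglongrightarrow> (b - a) * 0"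
    using beta by (intro tendsto_mult tendsto_const LIMSEQ_realpow_zero) auto
  hence zero: "(\<lambda>j. (b - a) * (1 / \<beta>) ^ j) \<longlonglongrightarrow> 0" by simp
  have "(\<lambda>j. u 0 - approx j s) \<longlonglongrightarrow> 0"
    by (rule Lim_null_comparison[OF always_eventually zero]) (simp add: bound[of u s, OF u rec])
  moreover have "(\<lambda>j. u 0 - approx j s) \<longlonglongrightarrow> u 0 - point s"
    by (intro tendsto_diff tendsto_const approx_LIMSEQ)
  ultimately have "0 = u 0 - point s" by (rule LIMSEQ_unique)
  thus ?thesis by simp
qed

lemma measurable_point [measurable]: "point \<in> borel_measurable seqs"
proof -
  have approx: "approx j \<in> borel_measurable seqs" for j
  proof (induction j)
    case (Suc j)
    have "(\<lambda>s. G w (approx j (\<lambda>i. s (Suc i)))) \<in> borel_measurable seqs" for w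
      using measurable_compose[OF measurable_compose[OF measurable_tail Suc]
          borel_measurable_continuous_onI[OF G_continuous]] .
    from measurable_compose_countable[OF this measurable_seqs_component[of 0]] show ?case by simp
  qed simp
  show ?thesis unfolding point_def[abs_def] by (rule borel_measurable_lim_metric[OF approx])
qed

text \<open>The first label already names the end point if there is one. Sequences that mix
  end-point labels with others receive a conventional value; for every invariant measure they arise
  as itineraries only on a null set.\<close>

definition decode :: "(nat \<Rightarrow> bool \<times> nat) \<Rightarrow> (nat \<Rightarrow> bool) \<times> real" where
  "decode s = (\<lambda>i. fst (s i), if snd (s 0) = 0 then a else if snd (s 0) = Suc m then b else point s)"

lemma measurable_decode: "decode \<in> seqs \<rightarrow>\<^sub>M X"
  unfolding decode_def
proof (rule measurable_into_X)
  show "(\<lambda>s i. fst (s i)) \<in> seqs \<rightarrow>\<^sub>M Omega"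
    unfolding Omega_eq_seqs
    by (intro measurable_into_seqs measurable_compose[OF measurable_seqs_component]) simp
  have "{s \<in> space seqs. snd (s 0) = k} \<in> sets (seqs :: (nat \<Rightarrow> bool \<times> nat) measure)" for k :: nat
  proof -
    have "{s \<in> space seqs. snd (s 0) = k} = (\<lambda>s :: nat \<Rightarrow> bool \<times> nat. s 0) -` (UNIV \<times> {k}) \<inter> space seqs"
      by (auto simp: mem_Times_iff)
    also have "\<dots> \<in> sets seqs" by (rule measurable_sets[OF measurable_seqs_component]) simp
    finally show ?thesis .
  qed
  thus "(\<lambda>s. if snd (s 0) = 0 then a else if snd (s 0) = Suc m then b else point s) \<in> borel_measurable seqs"
    by (intro measurable_If measurable_const measurable_point) simp_all
qed (use point_bounds a_less_b in auto)

lemma interior_label: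
  assumes p: "p \<in> J" "p \<notin> Z"
  shows "label p \<in> UNIV \<times> {1..m}" "snd p = G (label p) (snd (I p))"
proof -
  obtain \<omega> x where Pair: "p = (\<omega>, x)" by (cases p)
  have x: "a < x" "x < b" using p by (auto simp: Pair Z_def)
  obtain k y where "1 \<le> k" "k \<le> m" "x = F (\<omega> 0, k) y" "ret (\<omega>, x) = Suc k" "I (\<omega>, x) = (shift \<omega>, y)"
    using interior_branch[OF x] by metis
  thus "label p \<in> UNIV \<times> {1..m}" "snd p = G (label p) (snd (I p))"
    using x by (auto simp: Pair label_def G_def)
qed

text \<open>Off \<open>Z\<close> the second coordinates of the orbit satisfy the recursion whose
  only bounded solution starts at \<open>point\<close>; the assumption \<open>inv\<close> keeps the
  whole orbit there.\<close>

lemma decode_itinerary: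
  assumes p: "p \<in> J" and inv: "\<And>i. (I ^^ i) p \<in> Z \<longleftrightarrow> p \<in> Z"
  shows "decode (itinerary I label p) = p"
proof (rule prod_eqI)
  show "fst (decode (itinerary I label p)) = fst p"
    using p by (simp add: decode_def itinerary_def fst_label_pow)
  show "snd (decode (itinerary I label p)) = snd p"
  proof (cases "p \<in> Z")
    case True
    thus ?thesis using a_less_b by (auto simp: decode_def itinerary_def label_def Z_def)
  next
    case False
    have q: "(I ^^ i) p \<in> J" "(I ^^ i) p \<notin> Z" for i
      using p inv False by (auto intro: I_pow_J simp del: mem_Times_iff)
    have "snd ((I ^^ 0) p) = point (itinerary I label p)"
    proof (rule point_unique)
      show "a \<le> snd ((I ^^ j) p)" "snd ((I ^^ j) p) \<le> b" for j using q(1)[of j] by auto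
      show "snd ((I ^^ j) p) = G (itinerary I label p j) (snd ((I ^^ Suc j) p))" for j
        using interior_label(2)[OF q] by (simp add: itinerary_def)
    qed
    moreover have "snd (label p) \<noteq> 0" "snd (label p) \<noteq> Suc m"
      using interior_label(1)[OF q[of 0]] by auto
    ultimately show ?thesis by (simp add: decode_def itinerary_def)
  qed
qed

section \<open>Counting words on and off the end points\<close>

definition S :: "(bool \<times> nat) set" where "S = UNIV \<times> {1..m}"

lemma card_S: "finite S" "card S = 2 * m" "S \<noteq> {}"
  using m by (auto simp: S_def card_cartesian_product)

definition S_words :: "nat \<Rightarrow> (bool \<times> nat) list set" where
  "S_words j = {w. set w \<subseteq> S \<and> length w = j}"

lemma card_S_words: "finite (S_words j)" "card (S_words j) = (2 * m) ^ j" "S_words j \<noteq> {}"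
proof -
  show "finite (S_words j)" "card (S_words j) = (2 * m) ^ j"
    unfolding S_words_def using card_S by (auto simp: finite_lists_length_eq card_lists_length_eq)
  thus "S_words j \<noteq> {}" using m by (metis card.empty mult_eq_0_iff not_numeral_le_zero power_not_zero zero_neq_numeral)
qed

text \<open>A word of length \<open>j\<close> on \<open>Z\<close> is encoded by its \<open>j\<close>
  digits and one bit \<open>t\<close> telling whether the orbit starts at \<open>a\<close>: the end
  point at time \<open>i > 0\<close> is dictated by the digit at time \<open>i - 1\<close>.\<close>

lemma card_Z_words: "finite (word I label j ` Z)" "card (word I label j ` Z) \<le> 2 ^ Suc j"
proof -
  define h :: "bool list \<times> bool \<Rightarrow> (bool \<times> nat) list" where
    "h = (\<lambda>(l, t). map (\<lambda>i. (l ! i, if (if i = 0 then t else l ! (i - 1)) then 0 else Suc m)) [0..<j])"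
  let ?D = "{l. set l \<subseteq> (UNIV :: bool set) \<and> length l = j} \<times> (UNIV :: bool set)"
  have sub: "word I label j ` Z \<subseteq> h ` ?D"
  proof
    fix w assume "w \<in> word I label j ` Z"
    then obtain p where p: "p \<in> Z" and w: "w = word I label j p" by auto
    have Zi: "(I ^^ i) p \<in> Z" for i by (induction i) (use p I_Z in auto)
    have snd_label: "snd (label ((I ^^ i) p)) = (if snd ((I ^^ i) p) = a then 0 else Suc m)" for i
      using Zi[of i] by (auto simp: label_def Z_def)
    have step: "snd ((I ^^ Suc i) p) = (if fst p i then a else b)" for i
    proof -
      have J: "p \<in> J" using p Z_subset by blast
      obtain \<omega> x where q: "(I ^^ i) p = (\<omega>, x)" by (cases "(I ^^ i) p")
      have "x \<in> {a, b}" using Zi[of i] by (simp add: q Z_def)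
      from I_boundary[OF this, of \<omega>] have "snd ((I ^^ Suc i) p) = (if \<omega> 0 then a else b)" by (simp add: q)
      moreover have "\<omega> 0 = fst p i" using fst_I_pow[OF J, of i] q by simp
      ultimately show ?thesis by simp
    qed
    have "label ((I ^^ i) p) = (fst p i, if (if i = 0 then snd p = a else fst p (i - 1)) then 0 else Suc m)" for i
    proof (rule prod_eqI)
      show "fst (label ((I ^^ i) p)) = fst (fst p i, if (if i = 0 then snd p = a else fst p (i - 1)) then 0 else Suc m)"
        using fst_label_pow[of p i] p Z_subset by auto
      show "snd (label ((I ^^ i) p)) = snd (fst p i, if (if i = 0 then snd p = a else fst p (i - 1)) then 0 else Suc m)"
      proof (cases i)
        case (Suc i')
        thus ?thesis unfolding snd_label Suc step using a_less_b by simp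
      qed (simp add: snd_label[of 0, simplified])
    qed
    hence "w = h (map (fst p) [0..<j], snd p = a)"
      by (auto simp: w h_def word_def intro!: nth_equalityI)
    moreover have "(map (fst p) [0..<j], snd p = a) \<in> ?D" by simp
    ultimately show "w \<in> h ` ?D" by blast
  qed
  have D: "finite ?D" "card ?D = 2 ^ Suc j"
    using finite_lists_length_eq[of "UNIV :: bool set" j] card_lists_length_eq[of "UNIV :: bool set" j]
    by (simp_all add: card_cartesian_product)
  show "finite (word I label j ` Z)" by (rule finite_subset[OF sub finite_imageI[OF D(1)]])
  show "card (word I label j ` Z) \<le> 2 ^ Suc j" using surj_card_le[OF D(1) sub] D(2) by simp
qed

end

section \<open>Invariant measures\<close>

lemma (in prob_space) sum_prob_vimage:
  assumes W: "simple_function M W" and "finite A"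
  shows "(\<Sum>v\<in>A. prob (W -` {v} \<inter> space M)) = prob (W -` A \<inter> space M)"
proof -
  have "W -` A \<inter> space M = (\<Union>v\<in>A. W -` {v} \<inter> space M)" by auto
  also have "prob \<dots> = (\<Sum>v\<in>A. prob (W -` {v} \<inter> space M))"
    using assms by (intro finite_measure_finite_Union)
      (auto simp: simple_functionD(2) disjoint_family_on_def)
  finally show ?thesis by simp
qed

lemma (in prob_space) fun_entropy_eq_sum:
  assumes W: "simple_function M W" and "finite A" and AE: "AE x in M. W x \<in> A"
  shows "fun_entropy M W
    = - (\<Sum>v\<in>A. prob (W -` {v} \<inter> space M) * ln (prob (W -` {v} \<inter> space M)))"
proof -
  let ?p = "\<lambda>v. prob (W -` {v} \<inter> space M)"
  have fin: "finite (W ` space M)" using W by (rule simple_functionD(1))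
  have out: "?p v = 0" if "v \<notin> A" for v
  proof -
    have "AE x in M. x \<notin> W -` {v} \<inter> space M" using AE that by auto
    thus ?thesis using W by (simp add: simple_functionD(2) prob_eq_0)
  qed
  have out': "?p v = 0" if "v \<notin> W ` space M" for v
  proof -
    have "W -` {v} \<inter> space M = {}" using that by blast
    thus ?thesis by simp
  qed
  have "(\<Sum>v\<in>W ` space M. ?p v * ln (?p v)) = (\<Sum>v\<in>W ` space M \<union> A. ?p v * ln (?p v))"
    using fin \<open>finite A\<close> by (intro sum.mono_neutral_left) (auto simp: out')
  also have "\<dots> = (\<Sum>v\<in>A. ?p v * ln (?p v))"
    using fin \<open>finite A\<close> by (intro sum.mono_neutral_right) (auto simp: out)
  finally show ?thesis by (simp add: fun_entropy_def)
qed

locale invariant_measure = shrinking_beta +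
  fixes \<mu> :: "((nat \<Rightarrow> bool) \<times> real) measure"
  assumes inv: "\<mu> \<in> invariant_probs (switch_space \<beta>) (induced_K \<beta>)"

sublocale invariant_measure \<subseteq> mpt \<mu> "induced_K \<beta>"
proof -
  have "prob_space \<mu>" "induced_K \<beta> \<in> \<mu> \<rightarrow>\<^sub>M \<mu>" "distr \<mu> \<mu> (induced_K \<beta>) = \<mu>"
    using inv by (auto simp: invariant_probs_def)
  thus "mpt \<mu> (induced_K \<beta>)" by (simp add: mpt_def mpt_axioms_def)
qed

context invariant_measure
begin

lemma sets_mu: "sets \<mu> = sets X"
  using inv by (simp add: invariant_probs_def)

lemma space_mu: "space \<mu> = J"
  using sets_eq_imp_space_eq[OF sets_mu] space_X by simp

lemma simple_function_label: "simple_function \<mu> label"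
proof -
  have "label \<in> \<mu> \<rightarrow>\<^sub>M count_space UNIV"
    using measurable_label measurable_cong_sets[OF sets_mu refl] by blast
  moreover have "label ` space \<mu> \<subseteq> UNIV \<times> {..Suc m}"
    using label_range unfolding space_mu by blast
  hence "finite (label ` space \<mu>)" by (rule finite_subset) simp
  ultimately show ?thesis
    unfolding simple_function_def by (auto intro: measurable_sets)
qed

lemma sets_Z: "Z \<in> sets \<mu>"
proof -
  have "Z = (\<lambda>p. p) -` (UNIV \<times> {a, b}) \<inter> space X"
    using Z_subset by (auto simp: Z_def space_X)
  also have "\<dots> \<in> sets X"
  proof (rule measurable_sets[OF measurable_X_borel])
    have "UNIV \<in> sets (Omega :: (nat \<Rightarrow> bool) measure)"
      using sets.top[of Omega] by (simp add: Omega_eq_seqs)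
    thus "UNIV \<times> {a, b} \<in> sets (Omega \<Otimes>\<^sub>M borel)" by (intro pair_measureI) auto
  qed
  finally show ?thesis by (simp add: sets_mu)
qed

text \<open>\<open>Z\<close> is contained in its preimage, and invariance gives both the same
  measure. So the points entering \<open>Z\<close> from outside are null, and so are those that do
  it at any later time.\<close>

lemma AE_Z_invariant: "AE p in \<mu>. p \<in> J \<and> (\<forall>i. (I ^^ i) p \<in> Z \<longleftrightarrow> p \<in> Z)"
proof -
  have I_vim: "I -` Z \<inter> space \<mu> \<in> sets \<mu>" by (intro measurable_sets[OF T_meas] sets_Z)
  have sub: "Z \<subseteq> I -` Z \<inter> space \<mu>" using I_Z Z_subset by (auto simp: space_mu)
  have "prob (I -` Z \<inter> space \<mu> - Z) = prob (I -` Z \<inter> space \<mu>) - prob Z"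
    by (rule finite_measure_Diff[OF I_vim sets_Z sub])
  also have "\<dots> = 0" using prob_pow[OF sets_Z, of 1] by simp
  finally have "AE p in \<mu>. p \<notin> I -` Z \<inter> space \<mu> - Z"
    using prob_eq_0[of "I -` Z \<inter> space \<mu> - Z"] I_vim sets_Z by auto
  hence "AE p in \<mu>. I p \<in> Z \<longrightarrow> p \<in> Z" using AE_space by eventually_elim auto
  from AE_pow[OF this] have "AE p in \<mu>. \<forall>i. I ((I ^^ i) p) \<in> Z \<longrightarrow> (I ^^ i) p \<in> Z"
    by (simp add: AE_all_countable)
  thus ?thesis using AE_space
  proof eventually_elim
    case (elim p)
    have "(I ^^ i) p \<in> Z \<longleftrightarrow> p \<in> Z" for i
    proof (induction i)
      case (Suc i)
      thus ?case using elim(1) I_Z[of "(I ^^ i) p"] by auto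
    qed simp
    thus ?case using elim(2) by (simp only: space_mu) blast
  qed
qed

lemma AE_decode: "AE p in \<mu>. decode (itinerary I label p) = p"
  using AE_Z_invariant by eventually_elim (rule decode_itinerary, auto)

lemma measurable_decode_mu: "decode \<in> seqs \<rightarrow>\<^sub>M \<mu>"
  using measurable_decode measurable_cong_sets[OF refl sets_mu] by blast

lemma ks_entropy_eq: "ks_entropy \<mu> I = ereal (fun_rate label)"
  by (rule ks_entropy_generator[OF simple_function_label measurable_decode_mu AE_decode])

abbreviation "z \<equiv> prob Z"
abbreviation "pw j v \<equiv> prob (word I label j -` {v} \<inter> space \<mu>)"

lemmas simple_function_words = simple_function_word[OF simple_function_label]

section \<open>Word distributions and the entropy bound\<close>

lemma word_cases:
  assumes "p \<in> J" "\<forall>i. (I ^^ i) p \<in> Z \<longleftrightarrow> p \<in> Z" "p \<notin> Z"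
  shows "word I label j p \<in> S_words j"
proof -
  have "label ((I ^^ i) p) \<in> S" for i
    unfolding S_def using assms by (intro interior_label(1) I_pow_J) auto
  thus ?thesis by (auto simp: S_words_def word_def)
qed

text \<open>The first letter decides, as the marks of the end points lie outside \<open>S\<close>.
  The empty word belongs to both sides as soon as \<open>j = 0\<close>.\<close>

lemma words_disjoint:
  assumes "1 \<le> j" shows "S_words j \<inter> word I label j ` Z = {}"
proof -
  have "word I label j p \<notin> S_words j" if "p \<in> Z" for p
  proof
    assume "word I label j p \<in> S_words j"
    moreover have "label p \<in> set (word I label j p)"
      using assms nth_mem[of 0 "word I label j p"] by simp
    ultimately have "label p \<in> S" by (auto simp: S_words_def)
    thus False using that by (auto simp: S_def label_def Z_def split: if_splits)
  qed
  thus ?thesis by auto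
qed

lemma prob_words:
  assumes j: "1 \<le> j"
  shows "sum (pw j) (S_words j) = 1 - z" "sum (pw j) (word I label j ` Z) = z"
proof -
  let ?W = "word I label j"
  have S: "?W -` A \<inter> space \<mu> \<in> sets \<mu>" for A
    by (rule simple_functionD(2)[OF simple_function_words])
  have "prob (?W -` S_words j \<inter> space \<mu>) = prob (space \<mu> - Z)"
  proof (rule finite_measure_eq_AE)
    show "AE p in \<mu>. p \<in> ?W -` S_words j \<inter> space \<mu> \<longleftrightarrow> p \<in> space \<mu> - Z"
      using AE_Z_invariant
      by eventually_elim (use words_disjoint[OF j] word_cases in auto)
  qed (use S sets_Z in auto)
  thus "sum (pw j) (S_words j) = 1 - z"
    using sum_prob_vimage[OF simple_function_words card_S_words(1)] prob_compl[OF sets_Z] by simp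
  have "prob (?W -` (?W ` Z) \<inter> space \<mu>) = z"
  proof (rule finite_measure_eq_AE)
    show "AE p in \<mu>. p \<in> ?W -` (?W ` Z) \<inter> space \<mu> \<longleftrightarrow> p \<in> Z"
      using AE_Z_invariant
    proof eventually_elim
      case (elim p)
      hence "p \<in> space \<mu>" by (simp only: space_mu)
      thus ?case using elim words_disjoint[OF j] word_cases[of p j] by blast
    qed
  qed (use S sets_Z in auto)
  thus "sum (pw j) (?W ` Z) = z"
    using sum_prob_vimage[OF simple_function_words card_Z_words(1)] by simp
qed

lemma fun_entropy_words:
  assumes j: "1 \<le> j"
  shows "fun_entropy \<mu> (word I label j) = - (\<Sum>v\<in>S_words j. pw j v * ln (pw j v))
    + - (\<Sum>v\<in>word I label j ` Z. pw j v * ln (pw j v))"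
proof -
  have "AE p in \<mu>. word I label j p \<in> S_words j \<union> word I label j ` Z"
    using AE_Z_invariant by eventually_elim (use word_cases in blast)
  from fun_entropy_eq_sum[OF simple_function_words _ this]
  show ?thesis using card_S_words(1) card_Z_words(1) words_disjoint[OF j]
    by (simp add: sum.union_disjoint)
qed

lemma fun_rate_label_le: "fun_rate label \<le> (1 - z) * ln (2 * real m) + z * ln 2"
proof (rule LIMSEQ_le)
  show "(\<lambda>j. fun_entropy \<mu> (word I label j) / real j) \<longlonglongrightarrow> fun_rate label"
    by (rule fun_rate_LIMSEQ[OF simple_function_label])
  \<comment> \<open>In \<open>?c\<close>, the term \<open>z * ln 2\<close> pays for the extra bit of
    the words on \<open>Z\<close>, and 1 is the total of the two slacks \<open>z\<close> and
    \<open>1 - z\<close> from \<open>neg_sum_ln_le\<close>.\<close>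
  let ?r = "(1 - z) * ln (2 * real m) + z * ln 2" and ?c = "z * ln 2 + 1"
  have "(\<lambda>j. ?r + ?c * (1 / real j)) \<longlonglongrightarrow> ?r + ?c * 0"
    by (intro tendsto_add tendsto_mult tendsto_const lim_1_over_n)
  thus "(\<lambda>j. ?r + ?c * (1 / real j)) \<longlonglongrightarrow> ?r" by simp
  show "\<exists>N. \<forall>j\<ge>N. fun_entropy \<mu> (word I label j) / real j \<le> ?r + ?c * (1 / real j)"
  proof (intro exI[of _ 1] allI impI)
    fix j :: nat assume j: "1 \<le> j"
    have ln_pow: "ln ((2 * real m) ^ j) = real j * ln (2 * real m)"
      "ln (2 ^ Suc j) = real (Suc j) * ln (2 :: real)"
      using m by (simp_all only: ln_realpow)
    have "- (\<Sum>v\<in>S_words j. pw j v * ln (pw j v))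
        \<le> sum (pw j) (S_words j) * ln ((2 * real m) ^ j) + 1 - sum (pw j) (S_words j)"
      using card_S_words(1,2)[of j] m by (intro neg_sum_ln_le) auto
    moreover have "- (\<Sum>v\<in>word I label j ` Z. pw j v * ln (pw j v))
        \<le> sum (pw j) (word I label j ` Z) * ln (2 ^ Suc j) + 1 - sum (pw j) (word I label j ` Z)"
    proof (intro neg_sum_ln_le card_Z_words(1))
      show "real (card (word I label j ` Z)) \<le> 2 ^ Suc j"
        using card_Z_words(2)[of j] by (metis of_nat_le_iff of_nat_numeral of_nat_power)
    qed auto
    ultimately have "fun_entropy \<mu> (word I label j)
        \<le> (1 - z) * (real j * ln (2 * real m)) + z * (real (Suc j) * ln 2) + 1"
      unfolding fun_entropy_words[OF j] prob_words[OF j] ln_pow by linarith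
    also have "\<dots> = ?r * real j + ?c" by (simp add: algebra_simps)
    finally show "fun_entropy \<mu> (word I label j) / real j \<le> ?r + ?c * (1 / real j)"
      using j by (simp add: field_simps)
  qed
qed

lemma ks_entropy_le: "ks_entropy \<mu> I \<le> ereal (ln (2 * real m))"
proof -
  have "z * ln 2 \<le> z * ln (2 * real m)" using m by (intro mult_left_mono) auto
  with fun_rate_label_le have "fun_rate label \<le> ln (2 * real m)" by (simp add: algebra_simps)
  thus ?thesis by (simp add: ks_entropy_eq)
qed

text \<open>
  On \<open>Z\<close> the entropy is at most \<open>ln 2 < ln (2 m)\<close>, so maximality forces \<open>\<mu> Z = 0\<close>.
  The rate is an infimum over the word lengths, hence every word distribution has maximal entropy.
\<close>

lemma maximal_imp_uniform:
  assumes "ks_entropy \<mu> I = ereal (ln (2 * real m))" and w: "length w = j"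
  shows "pw j w = (if w \<in> S_words j then 1 / (2 * real m) ^ j else 0)"
proof -
  have rate: "fun_rate label = ln (2 * real m)" using assms ks_entropy_eq by simp
  have "ln 2 < ln (2 * real m)" using m by simp
  moreover have "z * (ln (2 * real m) - ln 2) \<le> 0"
    using fun_rate_label_le rate by (simp add: algebra_simps)
  ultimately have z: "z = 0" using measure_nonneg[of \<mu> Z] by (simp add: mult_le_0_iff)
  show ?thesis
  proof (cases "j = 0")
    case True
    have "word I label 0 -` {[]} \<inter> space \<mu> = space \<mu>" by auto
    thus ?thesis using True w by (simp add: prob_space S_words_def)
  next
    case False
    hence j: "1 \<le> j" by simp
    have pZ: "pw j v = 0" if "v \<in> word I label j ` Z" for v
      using prob_words(2)[OF j] that card_Z_words(1)[of j] by (auto simp: z sum_nonneg_eq_0_iff)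
    have pS: "sum (pw j) (S_words j) = 1" using prob_words(1)[OF j] z by simp
    show ?thesis
    proof (cases "w \<in> S_words j")
      case True
      have card: "real (card (S_words j)) = (2 * real m) ^ j" by (simp add: card_S_words(2))
      have ln_pow: "ln ((2 * real m) ^ j) = real j * ln (2 * real m)"
        using m by (intro ln_realpow)
      have "real j * ln (2 * real m) \<le> fun_entropy \<mu> (word I label j)"
        using fun_rate_le[OF simple_function_label j] j by (simp add: rate field_simps)
      also have "\<dots> = - (\<Sum>v\<in>S_words j. pw j v * ln (pw j v))"
        unfolding fun_entropy_words[OF j] by (simp add: pZ)
      finally have "ln (real (card (S_words j))) \<le> - (\<Sum>v\<in>S_words j. pw j v * ln (pw j v))"
        by (simp only: card ln_pow)
      from neg_sum_ln_maximal[OF card_S_words(1,3) _ pS this True]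
      show ?thesis using True by (simp add: card)
    next
      case False
      have "sum (pw j) (insert w (S_words j)) = prob (word I label j -` insert w (S_words j) \<inter> space \<mu>)"
        using card_S_words(1) by (intro sum_prob_vimage simple_function_words) simp
      also have "\<dots> \<le> 1" by simp
      finally have "pw j w \<le> 0" using False card_S_words(1) pS by simp
      thus ?thesis using False measure_nonneg[of \<mu>] by (simp add: antisym)
    qed
  qed
qed

end

section \<open>The measure of maximal entropy\<close>

context shrinking_beta
begin

section \<open>The uniform Bernoulli measure and its typical sequences\<close>

definition bernoulli :: "(nat \<Rightarrow> bool \<times> nat) measure" where
  "bernoulli = (\<Pi>\<^sub>M i\<in>UNIV. measure_pmf (pmf_of_set S))"

lemma prob_space_bernoulli: "prob_space bernoulli"
  unfolding bernoulli_def by (intro prob_space_PiM prob_space_measure_pmf)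

lemma sets_bernoulli: "sets bernoulli = sets seqs"
  unfolding bernoulli_def seqs_def by (intro sets_PiM_cong) auto

lemma space_bernoulli: "space bernoulli = UNIV"
  using sets_eq_imp_space_eq[OF sets_bernoulli] by simp

lemma measure_bernoulli_box:
  "measure bernoulli {s. \<forall>i<j. s i \<in> A i} = (\<Prod>i<j. real (card (S \<inter> A i)) / real (2 * m))"
proof -
  interpret B: prob_space bernoulli by (rule prob_space_bernoulli)
  interpret P: product_prob_space "\<lambda>_ :: nat. measure_pmf (pmf_of_set S)" UNIV ..
  have "emeasure bernoulli {s. \<forall>i<j. s i \<in> A i}
      = (\<Prod>i<j. emeasure (measure_pmf (pmf_of_set S)) (A i))"
    using P.emeasure_PiM_Collect[of "{..<j}" A]
    by (simp add: bernoulli_def space_PiM Ball_def)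
  also have "\<dots> = (\<Prod>i<j. ennreal (real (card (S \<inter> A i)) / real (2 * m)))"
    using card_S by (simp add: measure_pmf.emeasure_eq_measure measure_pmf_of_set)
  also have "\<dots> = ennreal (\<Prod>i<j. real (card (S \<inter> A i)) / real (2 * m))"
    by (intro prod_ennreal) simp
  finally show ?thesis
    by (simp add: B.emeasure_eq_measure prod_nonneg)
qed

lemma measure_bernoulli_word:
  assumes w: "length w = j"
  shows "measure bernoulli (seq_take j -` {w}) = (if w \<in> S_words j then 1 / (2 * real m) ^ j else 0)"
proof -
  have "seq_take j -` {w} = {s. \<forall>i<j. s i \<in> {w ! i}}"
    using w by (auto simp: seq_take_eq_iff simp del: map_eq_conv)
  hence *: "measure bernoulli (seq_take j -` {w}) = (\<Prod>i<j. real (card (S \<inter> {w ! i})) / real (2 * m))"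
    by (simp only: measure_bernoulli_box)
  show ?thesis
  proof (cases "w \<in> S_words j")
    case True
    hence "w ! i \<in> S" if "i < j" for i
      using that w by (auto simp: S_words_def)
    hence "(\<Prod>i<j. real (card (S \<inter> {w ! i})) / real (2 * m)) = (\<Prod>i<j. 1 / (2 * real m))"
      by (intro prod.cong) auto
    thus ?thesis using True * by (simp add: power_one_over)
  next
    case False
    then obtain i where i: "i < j" "w ! i \<notin> S"
      using w by (auto simp: S_words_def subset_iff in_set_conv_nth)
    hence "(\<Prod>i<j. real (card (S \<inter> {w ! i})) / real (2 * m)) = 0"
      by (intro prod_zero) auto
    thus ?thesis using False * by simp
  qed
qed

lemma AE_bernoulli_S: "AE s in bernoulli. \<forall>i. s i \<in> S"
proof -
  interpret P: product_prob_space "\<lambda>_ :: nat. measure_pmf (pmf_of_set S)" UNIV ..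
  have "AE s in bernoulli. s i \<in> S" for i
    unfolding bernoulli_def
    by (rule P.AE_component) (use card_S in \<open>auto simp: AE_measure_pmf_iff\<close>)
  thus ?thesis by (simp add: AE_all_countable)
qed

lemma bernoulli_shift: "distr bernoulli bernoulli (\<lambda>s i. s (Suc i)) = bernoulli"
  using distr_PiM_reindex[of UNIV "\<lambda>_ :: nat. measure_pmf (pmf_of_set S)" Suc UNIV]
  by (simp add: bernoulli_def prob_space_measure_pmf restrict_def)

text \<open>Each coordinate falls in \<open>T\<close> with probability at most
  \<open>2 / (2 m) \<le> 1 / 2\<close>, independently. \<open>T\<close> will be one of the
  two-letter alphabets to which the sequences decoding to an end point are confined.\<close>

lemma AE_bernoulli_not_all:
  assumes "card T = 2"
  shows "AE s in bernoulli. \<not> (\<forall>i. s i \<in> T)"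
proof -
  interpret B: prob_space bernoulli by (rule prob_space_bernoulli)
  have box: "{s. \<forall>i<j. s i \<in> T} \<in> sets bernoulli" for j
  proof -
    have "{s. \<forall>i<j. s i \<in> T} = cylinder j {w. set w \<subseteq> T}" by (auto simp: cylinder_def)
    thus ?thesis using sets_cylinder[of j] by (simp add: sets_bernoulli)
  qed
  have all: "{s :: nat \<Rightarrow> bool \<times> nat. \<forall>i. s i \<in> T} = (\<Inter>j. {s. \<forall>i<j. s i \<in> T})"
  proof (intro set_eqI iffI)
    fix s :: "nat \<Rightarrow> bool \<times> nat" assume s: "s \<in> (\<Inter>j. {s. \<forall>i<j. s i \<in> T})"
    have "s i \<in> T" for i
    proof -
      have "s \<in> {s. \<forall>k<Suc i. s k \<in> T}" using s by (rule INT_D) simp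
      thus ?thesis by simp
    qed
    thus "s \<in> {s. \<forall>i. s i \<in> T}" by simp
  qed simp
  have meas: "{s. \<forall>i. s i \<in> T} \<in> sets bernoulli" unfolding all using box by auto
  have "measure bernoulli {s. \<forall>i. s i \<in> T} \<le> (1 / 2) ^ j" for j
  proof -
    have "card (S \<inter> T) \<le> 2" using assms by (metis Int_lower2 card.infinite card_mono zero_neq_numeral)
    hence "real (card (S \<inter> T)) / real (2 * m) \<le> 1 / 2" using m by (simp add: field_simps)
    have "measure bernoulli {s. \<forall>i. s i \<in> T} \<le> measure bernoulli {s. \<forall>i<j. s i \<in> T}"
      using box by (intro B.finite_measure_mono) auto
    also have "\<dots> = (real (card (S \<inter> T)) / real (2 * m)) ^ j"
      unfolding measure_bernoulli_box by simp
    also have "\<dots> \<le> (1 / 2) ^ j" by (intro power_mono) (fact, simp)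
    finally show ?thesis .
  qed
  moreover have "(\<lambda>j. (1 / 2 :: real) ^ j) \<longlonglongrightarrow> 0" by (intro LIMSEQ_realpow_zero) auto
  ultimately have "measure bernoulli {s. \<forall>i. s i \<in> T} \<le> 0"
    by (intro LIMSEQ_le_const) auto
  hence "measure bernoulli {s. \<forall>i. s i \<in> T} = 0" using measure_nonneg by (metis antisym)
  hence "AE s in bernoulli. s \<notin> {s. \<forall>i. s i \<in> T}" using B.prob_eq_0[OF meas] by simp
  thus ?thesis by simp
qed

lemma point_step:
  assumes "\<forall>i. s i \<in> S" "s i = (d, k)"
  shows "1 \<le> k" "k \<le> m" "point (\<lambda>j. s (j + i)) = F (d, k) (point (\<lambda>j. s (j + Suc i)))"
proof -
  have "s i \<in> S" using assms(1) by blast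
  thus k: "1 \<le> k" "k \<le> m" using assms(2) by (auto simp: S_def)
  have "point (\<lambda>j. s (j + i)) = G (s i) (point (\<lambda>j. s (j + Suc i)))"
    using point_rec[of "\<lambda>j. s (j + i)"] by simp
  thus "point (\<lambda>j. s (j + i)) = F (d, k) (point (\<lambda>j. s (j + Suc i)))"
    using k assms(2) by (simp add: G_def)
qed

text \<open>A branch carries values above \<open>a\<close> to values above \<open>a\<close>, so the
  value \<open>a\<close> is inherited by every tail, and the equality case of
  \<open>F_bounds\<close> leaves one branch per digit. The same holds for \<open>b\<close>.\<close>

lemma point_boundary:
  assumes S: "\<forall>i. s i \<in> S"
  shows "point s = a \<Longrightarrow> s i \<in> {(True, m), (False, 1)}"
    "point s = b \<Longrightarrow> s i \<in> {(True, 1), (False, m)}"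
proof -
  have *: "(point (\<lambda>j. s (j + Suc i)) = a \<and> s i \<in> {(True, m), (False, 1)})"
    if "point (\<lambda>j. s (j + i)) = a" for i
  proof -
    obtain d k where dk: "s i = (d, k)" by (cases "s i")
    note st = point_step[OF S dk]
    have "point (\<lambda>j. s (j + Suc i)) = a"
      using F_bounds(3)[OF st(1,2) point_bounds, of "\<lambda>j. s (j + Suc i)" d]
        point_bounds(1)[of "\<lambda>j. s (j + Suc i)"] st(3) that by linarith
    moreover have "k = (if d then m else 1)"
      using F_bounds(5)[OF st(1,2) point_bounds] st(3) that by metis
    ultimately show ?thesis using dk by (cases d) auto
  qed
  have **: "(point (\<lambda>j. s (j + Suc i)) = b \<and> s i \<in> {(True, 1), (False, m)})"
    if "point (\<lambda>j. s (j + i)) = b" for i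
  proof -
    obtain d k where dk: "s i = (d, k)" by (cases "s i")
    note st = point_step[OF S dk]
    have "point (\<lambda>j. s (j + Suc i)) = b"
      using F_bounds(4)[OF st(1,2) point_bounds, of "\<lambda>j. s (j + Suc i)" d]
        point_bounds(2)[of "\<lambda>j. s (j + Suc i)"] st(3) that by linarith
    moreover have "k = (if d then 1 else m)"
      using F_bounds(6)[OF st(1,2) point_bounds] st(3) that by metis
    ultimately show ?thesis using dk by (cases d) auto
  qed
  show "s i \<in> {(True, m), (False, 1)}" if "point s = a"
  proof -
    have "point (\<lambda>j. s (j + i)) = a" for i
    proof (induction i)
      case (Suc i)
      thus ?case using *[of i] by blast
    qed (simp add: that)
    thus ?thesis using * by blast
  qed
  show "s i \<in> {(True, 1), (False, m)}" if "point s = b"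
  proof -
    have "point (\<lambda>j. s (j + i)) = b" for i
    proof (induction i)
      case (Suc i)
      thus ?case using **[of i] by blast
    qed (simp add: that)
    thus ?thesis using ** by blast
  qed
qed

text \<open>A set of full measure, stable under the shift, on which \<open>decode\<close>
  intertwines the shift with the induced map and is inverted by the itinerary.\<close>

definition good :: "(nat \<Rightarrow> bool \<times> nat) \<Rightarrow> bool" where
  "good s \<longleftrightarrow> (\<forall>i. s i \<in> S \<and> a < point (\<lambda>j. s (j + i)) \<and> point (\<lambda>j. s (j + i)) < b)"

lemma good_tail: "good s \<Longrightarrow> good (\<lambda>i. s (Suc i))"
  unfolding good_def
proof
  fix i
  assume "\<forall>i. s i \<in> S \<and> a < point (\<lambda>j. s (j + i)) \<and> point (\<lambda>j. s (j + i)) < b"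
  from this[rule_format, of "Suc i"]
  show "s (Suc i) \<in> S \<and> a < point (\<lambda>j. s (Suc (j + i))) \<and> point (\<lambda>j. s (Suc (j + i))) < b"
    by simp
qed

text \<open>Decoding to an end point confines a sequence to two letters, a null event; invariance
  under the shift extends this to all tails at once.\<close>

lemma AE_bernoulli_good: "AE s in bernoulli. good s"
proof -
  interpret B: mpt bernoulli "\<lambda>s i. s (Suc i)"
  proof (unfold mpt_def mpt_axioms_def, intro conjI prob_space_bernoulli bernoulli_shift)
    show "(\<lambda>s i. s (Suc i)) \<in> bernoulli \<rightarrow>\<^sub>M bernoulli"
      using measurable_tail measurable_cong_sets[OF sets_bernoulli sets_bernoulli] by blast
  qed
  have card: "card {(True, m), (False, 1)} = 2" "card {(True, 1), (False, m)} = 2" by simp_all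
  have "AE s in bernoulli. a < point s \<and> point s < b"
    using AE_bernoulli_S AE_bernoulli_not_all[OF card(1)] AE_bernoulli_not_all[OF card(2)]
  proof eventually_elim
    case (elim s)
    have "point s \<noteq> a"
    proof
      assume "point s = a"
      hence "\<forall>i. s i \<in> {(True, m), (False, 1)}" using point_boundary(1)[OF elim(1)] by (intro allI)
      with elim(2) show False ..
    qed
    moreover have "point s \<noteq> b"
    proof
      assume "point s = b"
      hence "\<forall>i. s i \<in> {(True, 1), (False, m)}" using point_boundary(2)[OF elim(1)] by (intro allI)
      with elim(3) show False ..
    qed
    ultimately have "a < point s" "point s < b" using point_bounds[of s] by linarith+
    thus ?case ..
  qed
  hence "AE s in bernoulli. a < point (((\<lambda>s i. s (Suc i)) ^^ i) s) \<and> point (((\<lambda>s i. s (Suc i)) ^^ i) s) < b" for i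
    by (rule B.AE_pow)
  moreover have "((\<lambda>s i. s (Suc i)) ^^ i) s = (\<lambda>j. s (j + i))" for i and s :: "nat \<Rightarrow> bool \<times> nat"
    by (induction i) auto
  ultimately have "AE s in bernoulli. \<forall>i. a < point (\<lambda>j. s (j + i)) \<and> point (\<lambda>j. s (j + i)) < b"
    by (simp add: AE_all_countable)
  thus ?thesis using AE_bernoulli_S unfolding good_def by eventually_elim blast
qed

text \<open>Strict bounds for the tail avoid the exceptional target in \<open>I_F\<close>; strict
  bounds for \<open>point s\<close> make the label come from the return time and not from an
  end-point mark.\<close>

lemma decode_good:
  assumes s: "good s"
  shows "I (decode s) = decode (\<lambda>i. s (Suc i))" "label (decode s) = s 0"
proof -
  have S: "\<forall>i. s i \<in> S" using s by (simp add: good_def)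
  have decode: "decode u = (\<lambda>i. fst (u i), point u)" if "good u" for u
  proof -
    have "u 0 \<in> S" using that by (simp add: good_def)
    thus ?thesis by (auto simp: decode_def S_def)
  qed
  obtain d k where dk: "s 0 = (d, k)" by (cases "s 0")
  define y where "y = point (\<lambda>i. s (Suc i))"
  have k: "1 \<le> k" "k \<le> m" "point s = F (d, k) y"
    using point_step[OF S dk] by (simp_all add: y_def)
  have y: "a < y" "y < b" and x: "a < point s" "point s < b"
    using s[unfolded good_def, rule_format, of 1] s[unfolded good_def, rule_format, of 0]
    by (simp_all add: y_def)
  have dec: "decode s = (\<lambda>i. fst (s i), F (d, k) y)" using decode[OF s] k(3) by simp
  have "ret (decode s) = Suc k \<and> I (decode s) = (shift (\<lambda>i. fst (s i)), y)"
    using I_F[OF k(1,2), of y "\<lambda>i. fst (s i)"] y dk unfolding dec by auto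
  moreover have "decode (\<lambda>i. s (Suc i)) = (shift (\<lambda>i. fst (s i)), y)"
    using decode[OF good_tail[OF s]] by (simp add: y_def shift_def)
  ultimately show "I (decode s) = decode (\<lambda>i. s (Suc i))" "label (decode s) = s 0"
    using x decode[OF s] dk by (auto simp: label_def)
qed

lemma itinerary_decode:
  assumes "good s"
  shows "itinerary I label (decode s) = s"
proof
  fix i
  have "(I ^^ i) (decode s) = decode (\<lambda>j. s (j + i)) \<and> good (\<lambda>j. s (j + i))"
  proof (induction i)
    case (Suc i)
    thus ?case using decode_good(1)[of "\<lambda>j. s (j + i)"] good_tail[of "\<lambda>j. s (j + i)"] by simp
  qed (simp add: assms)
  thus "itinerary I label (decode s) i = s i"
    using decode_good(2)[of "\<lambda>j. s (j + i)"] by (simp add: itinerary_def)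
qed

section \<open>Existence and uniqueness of the measure of maximal entropy\<close>

definition mme :: "((nat \<Rightarrow> bool) \<times> real) measure" where
  "mme = distr bernoulli X decode"

lemma measurable_decode_bernoulli: "decode \<in> bernoulli \<rightarrow>\<^sub>M X"
  using measurable_decode measurable_cong_sets[OF sets_bernoulli refl] by blast

lemma mme_invariant: "mme \<in> invariant_probs X I"
proof -
  interpret B: prob_space bernoulli by (rule prob_space_bernoulli)
  have tail: "(\<lambda>s i. s (Suc i)) \<in> bernoulli \<rightarrow>\<^sub>M bernoulli"
    using measurable_tail measurable_cong_sets[OF sets_bernoulli sets_bernoulli] by blast
  note dec = measurable_decode_bernoulli
  have sets: "sets mme = sets X" by (simp add: mme_def)
  have I: "I \<in> mme \<rightarrow>\<^sub>M mme" using measurable_I measurable_cong_sets[OF sets sets] by blast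
  have "distr mme mme I = distr mme X I" by (rule distr_cong) (simp_all add: sets)
  also have "\<dots> = distr bernoulli X (I \<circ> decode)"
    unfolding mme_def by (rule distr_distr[OF measurable_I dec])
  also have "\<dots> = distr bernoulli X (decode \<circ> (\<lambda>s i. s (Suc i)))"
  proof (rule distr_cong_AE)
    show "AE s in bernoulli. (I \<circ> decode) s = (decode \<circ> (\<lambda>s i. s (Suc i))) s"
      using AE_bernoulli_good by eventually_elim (simp add: decode_good)
  qed (use measurable_I tail dec in \<open>auto intro: measurable_comp\<close>)
  also have "\<dots> = distr (distr bernoulli bernoulli (\<lambda>s i. s (Suc i))) X decode"
    by (rule distr_distr[symmetric, OF dec tail])
  also have "\<dots> = mme" by (simp only: bernoulli_shift mme_def)
  finally have "distr mme mme I = mme" .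
  moreover have "prob_space mme" unfolding mme_def by (rule B.prob_space_distr[OF dec])
  ultimately show ?thesis using sets I by (simp add: invariant_probs_def)
qed

text \<open>The itinerary undoes \<open>decode\<close> almost surely, so words under
  \<open>mme\<close> are uniform on \<open>S_words j\<close>. Their entropy is exactly
  \<open>j * ln (2 m)\<close> for every \<open>j \<ge> 1\<close>, and the rate is a constant
  sequence's limit.\<close>

lemma ks_entropy_mme: "ks_entropy mme I = ereal (ln (2 * real m))"
proof -
  interpret invariant_measure \<beta> m mme
    by unfold_locales (rule mme_invariant)
  interpret B: prob_space bernoulli by (rule prob_space_bernoulli)
  have pw: "pw j w = (if w \<in> S_words j then 1 / (2 * real m) ^ j else 0)" if "length w = j" for j w
  proof -
    have W: "word I label j -` {w} \<inter> space mme \<in> sets mme"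
      by (rule simple_functionD(2)[OF simple_function_words])
    hence WX: "word I label j -` {w} \<inter> J \<in> sets X" by (simp only: sets_mu space_mu)
    have J: "decode s \<in> J" for s
      using measurable_space[OF measurable_decode, of s] by (simp add: space_X)
    have "pw j w = measure bernoulli (decode -` (word I label j -` {w} \<inter> J) \<inter> space bernoulli)"
      unfolding space_mu unfolding mme_def by (rule measure_distr[OF measurable_decode_bernoulli WX])
    also have "\<dots> = measure bernoulli (seq_take j -` {w})"
    proof (rule B.finite_measure_eq_AE)
      show "AE s in bernoulli. s \<in> decode -` (word I label j -` {w} \<inter> J) \<inter> space bernoulli
          \<longleftrightarrow> s \<in> seq_take j -` {w}"
        using AE_bernoulli_good
      proof eventually_elim
        case (elim s)
        have "word I label j (decode s) = seq_take j s"
          using itinerary_decode[OF elim] seq_take_itinerary[where T = I and f = label and x = "decode s" and m = j] by simp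
        thus ?case using J[of s] by (simp add: space_bernoulli del: mem_Times_iff)
      qed
      show "decode -` (word I label j -` {w} \<inter> J) \<inter> space bernoulli \<in> sets bernoulli"
        by (rule measurable_sets[OF measurable_decode_bernoulli WX])
      show "seq_take j -` {w} \<in> sets bernoulli"
        using sets_cylinder[of j "{w}"] by (simp add: sets_bernoulli cylinder_def)
    qed
    finally show ?thesis using measure_bernoulli_word[OF that] by simp
  qed
  have H: "fun_entropy mme (word I label j) / real j = ln (2 * real m)" if j: "1 \<le> j" for j
  proof -
    have S: "pw j v = 1 / (2 * real m) ^ j" if "v \<in> S_words j" for v
      using pw[of v j] that by (auto simp: S_words_def)
    have Z0: "pw j v = 0" if "v \<in> word I label j ` Z" for v
    proof -
      have v: "length v = j" and "v \<notin> S_words j" using that words_disjoint[OF j] by auto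
      thus ?thesis using pw[OF v] by simp
    qed
    have "fun_entropy mme (word I label j) = - (\<Sum>v\<in>S_words j. 1 / (2 * real m) ^ j * ln (1 / (2 * real m) ^ j))"
      unfolding fun_entropy_words[OF j] by (simp add: Z0 S)
    also have "\<dots> = - ln (1 / (2 * real m) ^ j)"
      using m by (simp add: card_S_words(2) power_mult_distrib)
    also have "\<dots> = ln ((2 * real m) ^ j)" using m by (subst ln_div) auto
    also have "\<dots> = real j * ln (2 * real m)" using m by (intro ln_realpow)
    finally show ?thesis using j by simp
  qed
  have "(\<lambda>j. fun_entropy mme (word I label j) / real j) \<longlonglongrightarrow> ln (2 * real m)"
    by (rule tendsto_eventually, rule eventually_sequentiallyI[of 1]) (rule H)
  hence "fun_rate label = ln (2 * real m)"
    by (rule LIMSEQ_unique[OF fun_rate_LIMSEQ[OF simple_function_label]])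
  thus ?thesis by (simp add: ks_entropy_eq)
qed

text \<open>Uniform word probabilities identify the law of the itineraries as
  \<open>bernoulli\<close>; \<open>decode\<close>, a left inverse of the itinerary almost
  everywhere, carries that law back to \<mu>.\<close>

lemma mme_unique:
  assumes "\<mu> \<in> invariant_probs X I" and max: "ks_entropy \<mu> I = ereal (ln (2 * real m))"
  shows "\<mu> = mme"
proof -
  interpret invariant_measure \<beta> m \<mu> by unfold_locales fact
  have "label \<in> \<mu> \<rightarrow>\<^sub>M count_space UNIV" by (rule measurable_simple_function[OF simple_function_label])
  hence it: "itinerary I label \<in> \<mu> \<rightarrow>\<^sub>M seqs" by (rule measurable_itinerary)
  have "distr \<mu> seqs (itinerary I label) = bernoulli"
  proof (rule seqs_measure_eqI)
    fix j and w :: "(bool \<times> nat) list" assume w: "length w = j"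
    have "measure (distr \<mu> seqs (itinerary I label)) (seq_take j -` {w})
        = prob (itinerary I label -` (seq_take j -` {w}) \<inter> space \<mu>)"
      using sets_cylinder[of j "{w}"] by (intro measure_distr it) (simp add: cylinder_def)
    also have "itinerary I label -` (seq_take j -` {w}) = word I label j -` {w}"
      by (auto simp del: map_eq_conv)
    also have "prob (word I label j -` {w} \<inter> space \<mu>) = measure bernoulli (seq_take j -` {w})"
      using maximal_imp_uniform[OF max w] measure_bernoulli_word[OF w] by simp
    finally show "measure (distr \<mu> seqs (itinerary I label)) (seq_take j -` {w})
        = measure bernoulli (seq_take j -` {w})" .
  qed (simp_all add: prob_space_distr[OF it] prob_space_bernoulli sets_bernoulli)
  hence "mme = distr (distr \<mu> seqs (itinerary I label)) X decode" by (simp add: mme_def)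
  also have "\<dots> = distr \<mu> X (decode \<circ> itinerary I label)"
    by (rule distr_distr[OF measurable_decode it])
  also have "\<dots> = distr \<mu> X (\<lambda>p. p)"
  proof (rule distr_cong_AE)
    show "AE p in \<mu>. (decode \<circ> itinerary I label) p = p" using AE_decode by simp
    show "decode \<circ> itinerary I label \<in> \<mu> \<rightarrow>\<^sub>M X" by (rule measurable_comp[OF it measurable_decode])
    show "(\<lambda>p. p) \<in> \<mu> \<rightarrow>\<^sub>M X" by (rule measurable_ident_sets[OF sets_mu])
  qed (rule refl)+
  also have "\<dots> = \<mu>" by (rule distr_id2[OF sets_mu[symmetric]])
  finally show ?thesis by simp
qed

lemma maximal_entropy_eq: "maximal_entropy X I = ereal (ln (2 * real m))"
proof (rule antisym)
  show "maximal_entropy X I \<le> ereal (ln (2 * real m))"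
    unfolding maximal_entropy_def
  proof (rule SUP_least)
    fix \<mu> assume "\<mu> \<in> invariant_probs X I"
    then interpret invariant_measure \<beta> m \<mu> by unfold_locales
    show "ks_entropy \<mu> I \<le> ereal (ln (2 * real m))" by (rule ks_entropy_le)
  qed
  show "ereal (ln (2 * real m)) \<le> maximal_entropy X I"
    unfolding maximal_entropy_def ks_entropy_mme[symmetric] by (rule SUP_upper[OF mme_invariant])
qed

lemma intrinsically_ergodic_I: "intrinsically_ergodic X I"
  unfolding intrinsically_ergodic_def measure_of_maximal_entropy_def maximal_entropy_eq
  using mme_invariant ks_entropy_mme mme_unique by blast

end

theorem theorem2p6:
  fixes n :: nat and \<beta> :: real
  assumes "n \<ge> 3"
    and "1 < \<beta>" and "\<beta> < 2"
    and "\<beta> ^ n = (\<Sum>k=0..n-2. \<beta> ^ k)"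
    and "\<And>x::real. 0 < x \<Longrightarrow> x ^ n = (\<Sum>k=0..n-2. x ^ k) \<Longrightarrow> x \<le> \<beta>"
  shows "intrinsically_ergodic (switch_space \<beta>) (induced_K \<beta>) \<and>
         maximal_entropy (switch_space \<beta>) (induced_K \<beta>) = ereal (ln (2 * real n - 2))"
proof -
  define m where "m = n - 1"
  have n: "n = Suc m" "2 \<le> m" using \<open>n \<ge> 3\<close> by (auto simp: m_def)
  have "{0..n - 2} = {..<m}" using n by auto
  hence "\<beta> * \<beta> ^ m = (\<Sum>k<m. \<beta> ^ k)" using assms(4) n(1) by simp
  \<comment> \<open>The factor \<open>\<beta> - 1\<close> collapses the geometric sum, which gives
    the form of the equation used as \<open>root\<close>.\<close>
  hence "(\<beta> - 1) * (\<beta> * \<beta> ^ m) = \<beta> ^ m - 1"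
    using power_diff_1_eq[of \<beta> m] by simp
  hence root: "\<beta> ^ m * (1 + \<beta> - \<beta>\<^sup>2) = 1"
    by (simp add: algebra_simps power2_eq_square)
  interpret shrinking_beta \<beta> m
    using assms(2) n(2) root by unfold_locales
  have "2 * real n - 2 = 2 * real m" using n by simp
  thus ?thesis using intrinsically_ergodic_I maximal_entropy_eq by simp
qed

end
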